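(* Let $\alpha,\beta$ be real numbers with $1<\beta-2\alpha\leq 2$. Let $\phi_0\in L^2(\mathbb{R})$ be odd, i.e. $\phi_0(-x)=-\phi_0(x)$, and let $\phi$ be the solution of \[ i\phi_t=(-\Delta)^{\beta/2}\phi \ \text{ in } \mathbb{R}^{1+1},\qquad \phi(x,0)=\phi_0(x). \] Then \[ \int_{-\infty}^{\infty}\int_{-\infty}^{\infty}\frac{\left|\,|\nabla|^{\alpha}\phi(x,t)\right|^2}{|x|^{\beta-2\alpha}}\,dx\,dt=\frac{2^{\beta-2\alpha}\,\Gamma(2-\beta+2\alpha)\,\sin\!\left(\frac{2-\beta+2\alpha}{2}\pi\right)}{\beta(\beta-1-2\alpha)}\,\|\phi_0\|_{L^2(\mathbb{R})}^2, \] where, in the case $\beta-2\alpha=2$, the product $\Gamma(2-\beta+2\alpha)\sin\!\left(\frac{2-\beta+2\alpha}{2}\pi\right)$ is understood as its limiting value $\lim_{s\to 0^+}\Gamma(s)\sin(s\pi/2)=\pi/2$. In particular, when $\alpha=0$ and $\beta=2$, \[ \int_{-\infty}^{\infty}\int_{-\infty}^{\infty}\frac{|\phi(x,t)|^2}{|x|^2}\,dx\,dt=\pi\,\|\phi_0\|_{L^2(\mathbb{R})}^2 . \] Equivalently, if $\psi(|x|,t)$ is a radial solution of the free Schrödinger equation $i\psi_t=-\Delta\psi$ in $\mathbb{R}^{3+1}$ with radial initial data in $L^2(\mathbb{R}^3)$, then \[ \int_{-\infty}^{\infty}\int_{\mathbb{R}^3}\frac{|\psi(|x|,t)|^2}{|x|^2}\,dx\,dt=\pi\,\|\psi(|\cdot|,0)\|_{L^2(\mathbb{R}^3)}^2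 . \]
   Context: Fourier transform convention: $\hat f(\xi)=\int_{\mathbb{R}}e^{-ix\xi}f(x)\,dx$. The operators $(-\Delta)^{\beta/2}$ and $|\nabla|^{\alpha}$ are the Fourier multipliers with symbols $|\xi|^{\beta}$ and $|\xi|^{\alpha}$; thus $\hat\phi(\xi,t)=e^{-i|\xi|^{\beta}t}\hat\phi_0(\xi)$ and $|\nabla|^{\alpha}\phi(x,t)=\frac{1}{2\pi}\int_{\mathbb{R}}|\xi|^{\alpha}e^{ix\xi}e^{-i|\xi|^{\beta}t}\hat\phi_0(\xi)\,d\xi$.
   Formalization: The formal theorem assumes β > 0: for β < 0 the right side is negative for φ₀ ≠ 0, and at β = 0 it is undefined. The equivalent reformulation for radial solutions of the free Schrödinger equation in R^{3+1} is not stated. *)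

theory Defs
  imports "HOL-Analysis.Analysis"
begin

definition L2_fun :: "(real \<Rightarrow> complex) \<Rightarrow> bool" where
  "L2_fun f \<longleftrightarrow> f \<in> borel_measurable lborel \<and>
     (\<integral>\<^sup>+ x. ennreal ((cmod (f x))\<^sup>2) \<partial>lborel) < \<infinity>"

definition L2_norm_sq :: "(real \<Rightarrow> complex) \<Rightarrow> real" where
  "L2_norm_sq f = (\<integral> x. (cmod (f x))\<^sup>2 \<partial>lborel)"

definition L2_fourier :: "(real \<Rightarrow> complex) \<Rightarrow> (real \<Rightarrow> complex) \<Rightarrow> bool" where
  "L2_fourier f fh \<longleftrightarrow> L2_fun fh \<and>
     ((\<lambda>R. \<integral>\<^sup>+ \<xi>. ennreal ((cmod (fh \<xi> -
         set_lebesgue_integral lborel {-R..R} (\<lambda>x. cis (- x * \<xi>) * f x)))\<^sup>2) \<partial>lborel)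
       \<longlongrightarrow> 0) at_top"

text \<open>Frequency-truncated version of
  |nabla|^alpha phi(x,t) = (1/2pi) int |xi|^alpha e^{i x xi} e^{-i |xi|^beta t} hat phi0(xi) d xi,
  the frequency integral taken over 1/R <= |xi| <= R.\<close>
definition trunc_sol :: "real \<Rightarrow> real \<Rightarrow> (real \<Rightarrow> complex) \<Rightarrow> real \<Rightarrow> real \<Rightarrow> real \<Rightarrow> complex" where
  "trunc_sol \<alpha> \<beta> ph R x t = complex_of_real (1 / (2 * pi)) *
     set_lebesgue_integral lborel {\<xi>. 1 / R \<le> \<bar>\<xi>\<bar> \<and> \<bar>\<xi>\<bar> \<le> R}
       (\<lambda>\<xi>. complex_of_real (\<bar>\<xi>\<bar> powr \<alpha>) * cis (x * \<xi>) * cis (- (\<bar>\<xi>\<bar> powr \<beta>) * t) * ph \<xi>)"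

text \<open>u is (a jointly measurable representative of) |nabla|^alpha phi, where phi solves
  i phi_t = (-Delta)^{beta/2} phi, phi(.,0) = phi0, and ph is the Fourier transform of phi0:
  for every x, u(x,.) is the L2(dt) limit of the frequency-truncated integrals.\<close>
definition frac_grad_sol :: "real \<Rightarrow> real \<Rightarrow> (real \<Rightarrow> complex) \<Rightarrow> (real \<Rightarrow> real \<Rightarrow> complex) \<Rightarrow> bool" where
  "frac_grad_sol \<alpha> \<beta> ph u \<longleftrightarrow>
     (\<lambda>(x, t). u x t) \<in> borel_measurable (lborel \<Otimes>\<^sub>M lborel) \<and>
     (\<forall>x. ((\<lambda>R. \<integral>\<^sup>+ t. ennreal ((cmod (u x t - trunc_sol \<alpha> \<beta> ph R x t))\<^sup>2) \<partial>lborel)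
             \<longlongrightarrow> 0) at_top)"

text \<open>The constant; for beta - 2 alpha = 2 the product Gamma(s) sin(s pi/2) is replaced by
  its limit pi/2 as s -> 0+.\<close>
definition kato_const :: "real \<Rightarrow> real \<Rightarrow> real" where
  "kato_const \<alpha> \<beta> =
     (let s = 2 - \<beta> + 2 * \<alpha>;
          G = (if s = 0 then pi / 2 else Gamma s * sin (s / 2 * pi))
      in 2 powr (\<beta> - 2 * \<alpha>) * G / (\<beta> * (\<beta> - 1 - 2 * \<alpha>)))"

end

theory Submission
  imports Defs "HOL-Probability.Probability" "HOL-Real_Asymp.Real_Asymp"
begin

text \<open>Write \<open>\<gamma> = \<beta> - 2\<alpha>\<close>. For fixed \<open>x\<close> the solution, folded onto positive frequencies by oddness, is after
  the substitution \<open>w = \<xi>\<^sup>\<beta>\<close> a Fourier transform in the variable \<open>t\<close>, so Plancherel in time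
  gives \<open>\<integral>|u(x,t)|\<^sup>2 dt = 2/(\<pi>\<beta>) \<integral>\<^sub>0\<^sup>\<infinity> \<xi>\<^sup>1\<^sup>-\<^sup>\<gamma> sin\<^sup>2(x\<xi>) |ph(\<xi>)|\<^sup>2 d\<xi>\<close>.
  Integrating against \<open>|x|\<^sup>-\<^sup>\<gamma>\<close> first in \<open>x\<close>, scaling cancels the power of \<open>\<xi>\<close> and leaves the constant
  \<open>\<integral> sin\<^sup>2 y / |y|\<^sup>\<gamma> dy\<close> times the \<open>L\<^sup>2\<close> norm of \<open>ph\<close> on the half line, to which
  Plancherel in space applies.\<close>

section \<open>Approximation in the \<open>L\<^sup>2\<close> norm\<close>

text \<open>Oddness is what makes the weight admissible: for \<gamma> > 1 the function
  \<open>\<bar>x\<bar> powr - \<gamma>\<close> is not integrable at 0, but folding replaces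
  \<open>cis (x * \<xi>)\<close> by \<open>sin (x * \<xi>)\<close>, whose square vanishes to second
  order there. The same condition \<gamma> > 1 gives convergence at infinity. The data and its
  transform are merely square-integrable, so their transforms need not be given by convergent
  integrals. Plancherel is therefore applied to truncations that are both integrable and
  square-integrable, and the truncation is removed by comparing squared norms. These norms live in
  \<open>ennreal\<close>, where exchanging integrals needs nothing beyond measurability. The
  prefactor 2/(\<pi>\<beta>) collects the 2\<pi> of Plancherel, the square of the 1/\<pi> left by
  folding, and the one factor 1/\<beta> that survives the Jacobian. The sine integral comes out with
  \<open>Gamma \<gamma>\<close> in the denominator, which is regular at \<gamma> = 2; the stated
  constant is formally infinity times 0 there, so that endpoint is matched separately.\<close>

lemma ennreal_le_of_le_mult:
  fixes a b :: ennreal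
  assumes "\<And>e::real. e > 0 \<Longrightarrow> a \<le> ennreal (1 + e) * b"
  shows "a \<le> b"
proof (cases b rule: ennreal_cases)
  case (real r)
  have "((\<lambda>e. ennreal ((1 + e) * r)) \<longlongrightarrow> ennreal ((1 + 0) * r)) (at_right 0)"
    by (intro tendsto_intros)
  moreover have "\<forall>\<^sub>F e in at_right 0. a \<le> ennreal ((1 + e) * r)"
    using eventually_at_right_less[of "0::real"]
    by (rule eventually_mono) (use assms real in \<open>auto simp: ennreal_mult'\<close>)
  ultimately have "a \<le> ennreal ((1 + 0) * r)"
    by (intro tendsto_lowerbound) auto
  then show ?thesis using real by simp
qed simp

text \<open>Triangle inequality, with the cross term absorbed by a weighted AM-GM. The factor of
  \<open>b\<close> can be taken as close to 1 as desired, while the large factor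
  \<open>1 + 1/e\<close> falls on a difference that will tend to 0.\<close>

lemma cmod_power2_le_weighted:
  fixes a b :: complex
  assumes "e > 0"
  shows "(cmod a)\<^sup>2 \<le> (1 + e) * (cmod b)\<^sup>2 + (1 + 1/e) * (cmod (a - b))\<^sup>2"
proof -
  have "(cmod a)\<^sup>2 \<le> (cmod b + cmod (a - b))\<^sup>2"
    by (intro power_mono) (use norm_triangle_ineq[of b "a - b"] in auto)
  also have "\<dots> = (cmod b)\<^sup>2 + (cmod (a - b))\<^sup>2 + 2 * cmod b * cmod (a - b)"
    by (simp add: power2_sum)
  also have "2 * cmod b * cmod (a - b) \<le> e * (cmod b)\<^sup>2 + 1/e * (cmod (a - b))\<^sup>2"
  proof -
    have "0 \<le> (e * cmod b - cmod (a - b))\<^sup>2 / e" using assms by simp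
    also have "\<dots> = e * (cmod b)\<^sup>2 + 1/e * (cmod (a - b))\<^sup>2 - 2 * cmod b * cmod (a - b)"
      using assms by (simp add: field_simps power2_eq_square)
    finally show ?thesis by simp
  qed
  finally show ?thesis by (simp add: algebra_simps)
qed

lemma nn_integral_cmod_power2_le_weighted:
  fixes f g :: "'a \<Rightarrow> complex"
  assumes [measurable]: "f \<in> borel_measurable M" "g \<in> borel_measurable M" and "e > 0"
  shows "(\<integral>\<^sup>+x. ennreal ((cmod (f x))\<^sup>2) \<partial>M)
    \<le> ennreal (1 + e) * (\<integral>\<^sup>+x. ennreal ((cmod (g x))\<^sup>2) \<partial>M)
      + ennreal (1 + 1/e) * (\<integral>\<^sup>+x. ennreal ((cmod (f x - g x))\<^sup>2) \<partial>M)"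
proof -
  have "(\<integral>\<^sup>+x. ennreal ((cmod (f x))\<^sup>2) \<partial>M) \<le> (\<integral>\<^sup>+x. ennreal (1 + e) * ennreal ((cmod (g x))\<^sup>2)
      + ennreal (1 + 1/e) * ennreal ((cmod (f x - g x))\<^sup>2) \<partial>M)"
    using cmod_power2_le_weighted[OF \<open>e > 0\<close>] \<open>e > 0\<close>
    by (intro nn_integral_mono) (simp flip: ennreal_mult' ennreal_plus)
  also have "\<dots> = ennreal (1 + e) * (\<integral>\<^sup>+x. ennreal ((cmod (g x))\<^sup>2) \<partial>M)
      + ennreal (1 + 1/e) * (\<integral>\<^sup>+x. ennreal ((cmod (f x - g x))\<^sup>2) \<partial>M)"
    by (simp add: nn_integral_add nn_integral_cmult)
  finally show ?thesis .
qed

text \<open>Continuity of the squared norm under L2 convergence, valid also when a norm is infinite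
  because nothing is subtracted. The weighted inequality is used in both directions with
  \<open>e\<close> fixed; the error term dies along \<open>F\<close>, after which \<open>e\<close>
  is sent to 0.\<close>

lemma L2_limit_norm_eq:
  fixes f :: "'a \<Rightarrow> complex"
  assumes [measurable]: "f \<in> borel_measurable M" "\<And>r. g r \<in> borel_measurable M"
    and F: "F \<noteq> bot"
    and D: "((\<lambda>r. \<integral>\<^sup>+x. ennreal ((cmod (f x - g r x))\<^sup>2) \<partial>M) \<longlongrightarrow> 0) F"
    and L: "((\<lambda>r. \<integral>\<^sup>+x. ennreal ((cmod (g r x))\<^sup>2) \<partial>M) \<longlongrightarrow> L) F"
  shows "(\<integral>\<^sup>+x. ennreal ((cmod (f x))\<^sup>2) \<partial>M) = L"
proof (rule antisym; rule ennreal_le_of_le_mult)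
  fix e :: real assume e: "e > 0"
  have "((\<lambda>r. ennreal (1 + e) * (\<integral>\<^sup>+x. ennreal ((cmod (g r x))\<^sup>2) \<partial>M)
      + ennreal (1 + 1/e) * (\<integral>\<^sup>+x. ennreal ((cmod (f x - g r x))\<^sup>2) \<partial>M))
    \<longlongrightarrow> ennreal (1 + e) * L + ennreal (1 + 1/e) * 0) F"
    by (intro tendsto_add ennreal_tendsto_cmult D L) auto
  then have "(\<integral>\<^sup>+x. ennreal ((cmod (f x))\<^sup>2) \<partial>M) \<le> ennreal (1 + e) * L + ennreal (1 + 1/e) * 0"
    by (rule tendsto_lowerbound)
      (use F e in \<open>auto intro!: always_eventually nn_integral_cmod_power2_le_weighted simp del: ennreal_plus\<close>)
  then show "(\<integral>\<^sup>+x. ennreal ((cmod (f x))\<^sup>2) \<partial>M) \<le> ennreal (1 + e) * L" by simp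
  have "((\<lambda>r. ennreal (1 + e) * (\<integral>\<^sup>+x. ennreal ((cmod (f x))\<^sup>2) \<partial>M)
      + ennreal (1 + 1/e) * (\<integral>\<^sup>+x. ennreal ((cmod (f x - g r x))\<^sup>2) \<partial>M))
    \<longlongrightarrow> ennreal (1 + e) * (\<integral>\<^sup>+x. ennreal ((cmod (f x))\<^sup>2) \<partial>M) + ennreal (1 + 1/e) * 0) F"
    by (intro tendsto_add ennreal_tendsto_cmult D tendsto_const) auto
  moreover have "(\<integral>\<^sup>+x. ennreal ((cmod (g r x))\<^sup>2) \<partial>M)
    \<le> ennreal (1 + e) * (\<integral>\<^sup>+x. ennreal ((cmod (f x))\<^sup>2) \<partial>M)
      + ennreal (1 + 1/e) * (\<integral>\<^sup>+x. ennreal ((cmod (f x - g r x))\<^sup>2) \<partial>M)" for r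
    using nn_integral_cmod_power2_le_weighted[of "g r" M f e] e by (simp add: norm_minus_commute)
  ultimately have "L \<le> ennreal (1 + e) * (\<integral>\<^sup>+x. ennreal ((cmod (f x))\<^sup>2) \<partial>M) + ennreal (1 + 1/e) * 0"
    using F L by (intro tendsto_le[of F]) auto
  then show "L \<le> ennreal (1 + e) * (\<integral>\<^sup>+x. ennreal ((cmod (f x))\<^sup>2) \<partial>M)" by simp
qed

lemma L2_truncation_tendsto:
  fixes g :: "real \<Rightarrow> complex"
  assumes [measurable]: "g \<in> borel_measurable borel"
    and fin: "(\<integral>\<^sup>+x. ennreal ((cmod (g x))\<^sup>2) \<partial>lborel) < \<infinity>"
  shows "(\<lambda>n. \<integral>\<^sup>+x. ennreal ((cmod (g x -
      (if cmod (g x) \<le> real n \<and> \<bar>x\<bar> \<le> real n then g x else 0)))\<^sup>2) \<partial>lborel) \<longlonglongrightarrow> 0"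
proof -
  have "(\<lambda>n. \<integral>\<^sup>+x. ennreal ((cmod (g x -
      (if cmod (g x) \<le> real n \<and> \<bar>x\<bar> \<le> real n then g x else 0)))\<^sup>2) \<partial>lborel)
      \<longlonglongrightarrow> (\<integral>\<^sup>+x. 0 \<partial>(lborel::real measure))"
  proof (rule nn_integral_dominated_convergence[OF _ _ _ _ fin])
    show "AE x in lborel. (\<lambda>n. ennreal ((cmod (g x -
      (if cmod (g x) \<le> real n \<and> \<bar>x\<bar> \<le> real n then g x else 0)))\<^sup>2)) \<longlonglongrightarrow> 0"
    proof (rule AE_I2)
      fix x
      obtain N where N: "max (cmod (g x)) \<bar>x\<bar> \<le> real N" using real_arch_simple by blast
      have "\<forall>\<^sub>F n in sequentially. ennreal ((cmod (g x -
          (if cmod (g x) \<le> real n \<and> \<bar>x\<bar> \<le> real n then g x else 0)))\<^sup>2) = 0"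
        using eventually_ge_at_top[of N] by eventually_elim (use N in auto)
      then show "(\<lambda>n. ennreal ((cmod (g x -
        (if cmod (g x) \<le> real n \<and> \<bar>x\<bar> \<le> real n then g x else 0)))\<^sup>2)) \<longlonglongrightarrow> 0"
        by (rule tendsto_eventually)
    qed
  qed auto
  then show ?thesis by simp
qed

text \<open>A measurable function is an a.e. limit of continuous ones. These are modified to share
  one bound and one bounded support, so that domination upgrades pointwise convergence to L2
  convergence.\<close>

lemma L2_approx_bounded_compact_support:
  fixes g :: "real \<Rightarrow> complex" and n :: real
  assumes [measurable]: "g \<in> borel_measurable borel"
    and n: "n > 0" and bd: "\<And>x. cmod (g x) \<le> n" and supp: "\<And>x. \<bar>x\<bar> > n \<Longrightarrow> g x = 0"
  obtains \<phi> where "\<And>k::nat. continuous_on UNIV (\<phi> k)" "\<And>k x. cmod (\<phi> k x) \<le> n"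
    "(\<lambda>k. \<integral>\<^sup>+x. ennreal ((cmod (g x - \<phi> k x))\<^sup>2) \<partial>lborel) \<longlonglongrightarrow> 0"
proof -
  have "g \<in> borel_measurable lebesgue"
    by (intro measurable_completion) auto
  then have "g measurable_on UNIV"
    by (rule lebesgue_measurable_imp_measurable_on) auto
  then obtain N \<psi> where N: "negligible N" and \<psi>: "\<And>k::nat. continuous_on UNIV (\<psi> k)"
    and lim: "\<And>x. x \<notin> N \<Longrightarrow> (\<lambda>k. \<psi> k x) \<longlonglongrightarrow> g x"
    unfolding measurable_on_def by auto
  \<comment> \<open>\<open>c\<close> is a cutoff equal to 1 on \<open>{-n..n}\<close> and to 0 off
    \<open>{-n-1..n+1}\<close>; \<open>cl\<close> is the radial retraction onto the disc of radius
    \<open>n\<close>. Both leave \<open>g\<close> unchanged, so the limit is not affected.\<close>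
  define c where "c x = max 0 (min 1 (n + 1 - \<bar>x\<bar>))" for x
  define cl where "cl z = z / complex_of_real (max 1 (cmod z / n))" for z
  define \<phi> where "\<phi> k x = cl (\<psi> k x) * complex_of_real (c x)" for k x
  have c01: "0 \<le> c x" "c x \<le> 1" for x by (auto simp: c_def)
  have contcl: "continuous_on UNIV cl"
    unfolding cl_def using n
    by (intro continuous_intros) (metis max.strict_coboundedI1 less_irrefl of_real_eq_0_iff zero_less_one)+
  have clb: "cmod (cl z) \<le> n" for z
  proof -
    have "cmod z \<le> n * max 1 (cmod z / n)"
      using n by (auto simp: max_def field_simps)
    then show ?thesis using n
      by (simp add: cl_def norm_divide divide_le_eq mult.commute)
  qed
  have cont: "continuous_on UNIV (\<phi> k)" for k
  proof -
    have "continuous_on UNIV (\<lambda>x. cl (\<psi> k x))"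
      by (rule continuous_on_compose2[OF contcl \<psi>]) auto
    then show ?thesis unfolding \<phi>_def c_def by (intro continuous_intros)
  qed
  have \<phi>b: "cmod (\<phi> k x) \<le> n" for k x
  proof -
    have "cmod (\<phi> k x) = cmod (cl (\<psi> k x)) * c x" using c01 by (simp add: \<phi>_def norm_mult)
    also have "\<dots> \<le> n * 1" using n by (intro mult_mono clb c01) auto
    finally show ?thesis by simp
  qed
  have [measurable]: "\<phi> k \<in> borel_measurable borel" for k
    using cont by (rule borel_measurable_continuous_onI)
  have "(\<lambda>k. \<integral>\<^sup>+x. ennreal ((cmod (g x - \<phi> k x))\<^sup>2) \<partial>lborel) \<longlonglongrightarrow> (\<integral>\<^sup>+x. 0 \<partial>(lborel::real measure))"
  proof (rule nn_integral_dominated_convergence[where w="\<lambda>x. ennreal ((2*n)\<^sup>2) * indicator {-n-1..n+1} x"])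
    show "AE x in lborel. ennreal ((cmod (g x - \<phi> k x))\<^sup>2) \<le> ennreal ((2*n)\<^sup>2) * indicator {-n-1..n+1} x" for k
    proof (rule AE_I2)
      fix x show "ennreal ((cmod (g x - \<phi> k x))\<^sup>2) \<le> ennreal ((2*n)\<^sup>2) * indicator {-n-1..n+1} x"
      proof (cases "\<bar>x\<bar> \<le> n + 1")
        case True
        have "cmod (g x - \<phi> k x) \<le> 2 * n"
          using norm_triangle_ineq4[of "g x" "\<phi> k x"] bd[of x] \<phi>b[of k x] by linarith
        then have "(cmod (g x - \<phi> k x))\<^sup>2 \<le> (2*n)\<^sup>2" by (intro power_mono) auto
        then show ?thesis using True by (auto simp: indicator_def intro!: ennreal_leI)
      next
        case False
        then have "g x = 0" "c x = 0" using supp[of x] by (auto simp: c_def)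
        then show ?thesis by (simp add: \<phi>_def)
      qed
    qed
    have "(\<integral>\<^sup>+x. ennreal ((2*n)\<^sup>2) * indicator {-n-1..n+1} x \<partial>lborel) = ennreal ((2*n)\<^sup>2) * ennreal (2*n+2)"
      using n by (simp add: nn_integral_cmult_indicator)
    then show "(\<integral>\<^sup>+x. ennreal ((2*n)\<^sup>2) * indicator {-n-1..n+1} x \<partial>lborel) < \<infinity>"
      by (simp add: ennreal_mult_less_top)
    have "AE x in lebesgue. x \<notin> N" using N AE_not_in by (simp add: negligible_iff_null_sets)
    then have "AE x in lborel. x \<notin> N" by (simp add: AE_completion_iff)
    then show "AE x in lborel. (\<lambda>k. ennreal ((cmod (g x - \<phi> k x))\<^sup>2)) \<longlonglongrightarrow> 0"
    proof eventually_elim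
      fix x assume "x \<notin> N"
      have "(\<lambda>k. cl (\<psi> k x)) \<longlonglongrightarrow> cl (g x)"
        using contcl lim[OF \<open>x \<notin> N\<close>] by (rule continuous_on_tendsto_compose) auto
      moreover have "cl (g x) = g x"
        using bd[of x] n by (simp add: cl_def max_def)
      moreover have "g x * complex_of_real (c x) = g x"
        using supp[of x] by (cases "\<bar>x\<bar> > n") (auto simp: c_def)
      ultimately have "(\<lambda>k. \<phi> k x) \<longlonglongrightarrow> g x"
        unfolding \<phi>_def by (metis tendsto_mult_right)
      then have "(\<lambda>k. ennreal ((cmod (g x - \<phi> k x))\<^sup>2)) \<longlonglongrightarrow> ennreal ((cmod (g x - g x))\<^sup>2)"
        by (intro tendsto_intros)
      then show "(\<lambda>k. ennreal ((cmod (g x - \<phi> k x))\<^sup>2)) \<longlonglongrightarrow> 0" by simp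
    qed
  qed auto
  then have "(\<lambda>k. \<integral>\<^sup>+x. ennreal ((cmod (g x - \<phi> k x))\<^sup>2) \<partial>lborel) \<longlonglongrightarrow> 0" by simp
  with cont \<phi>b show ?thesis by (rule that)
qed

lemma L2_approx_continuous:
  fixes g :: "real \<Rightarrow> complex"
  assumes [measurable]: "g \<in> borel_measurable borel"
    and fin: "(\<integral>\<^sup>+x. ennreal ((cmod (g x))\<^sup>2) \<partial>lborel) < \<infinity>" and d: "d > (0::real)"
  obtains \<phi> B where "continuous_on UNIV \<phi>" "\<And>x. cmod (\<phi> x) \<le> B"
    "(\<integral>\<^sup>+x. ennreal ((cmod (g x - \<phi> x))\<^sup>2) \<partial>lborel) < ennreal d"
proof -
  define tr where "tr n x = (if cmod (g x) \<le> real n \<and> \<bar>x\<bar> \<le> real n then g x else 0)" for n x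
  have [measurable]: "tr n \<in> borel_measurable borel" for n unfolding tr_def by measurable
  \<comment> \<open>Two errors below \<open>d/4\<close>, each doubled by the weighted inequality
    with \<open>e = 1\<close>, add up to less than \<open>d\<close>.\<close>
  have "\<forall>\<^sub>F n in sequentially. (\<integral>\<^sup>+x. ennreal ((cmod (g x - tr n x))\<^sup>2) \<partial>lborel) < ennreal (d/4) \<and> n > 0"
    using L2_truncation_tendsto[OF assms(1) fin] d unfolding tr_def
    by (intro eventually_conj order_tendstoD(2) eventually_gt_at_top) auto
  then obtain n where n: "(\<integral>\<^sup>+x. ennreal ((cmod (g x - tr n x))\<^sup>2) \<partial>lborel) < ennreal (d/4)" "n > 0"
    using eventually_happens by force
  obtain \<phi> where \<phi>: "\<And>k::nat. continuous_on UNIV (\<phi> k)" "\<And>k x. cmod (\<phi> k x) \<le> real n"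
    "(\<lambda>k. \<integral>\<^sup>+x. ennreal ((cmod (tr n x - \<phi> k x))\<^sup>2) \<partial>lborel) \<longlonglongrightarrow> 0"
    by (rule L2_approx_bounded_compact_support[of "tr n" "real n"]) (use n in \<open>auto simp: tr_def\<close>)
  have "\<forall>\<^sub>F k in sequentially. (\<integral>\<^sup>+x. ennreal ((cmod (tr n x - \<phi> k x))\<^sup>2) \<partial>lborel) < ennreal (d/4)"
    using \<phi>(3) d by (intro order_tendstoD(2)) auto
  then obtain k where k: "(\<integral>\<^sup>+x. ennreal ((cmod (tr n x - \<phi> k x))\<^sup>2) \<partial>lborel) < ennreal (d/4)"
    using eventually_happens by force
  have [measurable]: "\<phi> k \<in> borel_measurable borel"
    using \<phi>(1) by (rule borel_measurable_continuous_onI)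
  have "(\<integral>\<^sup>+x. ennreal ((cmod (g x - \<phi> k x))\<^sup>2) \<partial>lborel)
    \<le> ennreal (1 + 1) * (\<integral>\<^sup>+x. ennreal ((cmod (g x - tr n x))\<^sup>2) \<partial>lborel)
      + ennreal (1 + 1/1) * (\<integral>\<^sup>+x. ennreal ((cmod (g x - \<phi> k x - (g x - tr n x)))\<^sup>2) \<partial>lborel)"
    by (rule nn_integral_cmod_power2_le_weighted) auto
  also have "\<dots> = 2 * ((\<integral>\<^sup>+x. ennreal ((cmod (g x - tr n x))\<^sup>2) \<partial>lborel)
      + (\<integral>\<^sup>+x. ennreal ((cmod (tr n x - \<phi> k x))\<^sup>2) \<partial>lborel))"
    by (simp add: algebra_simps)
  also have "\<dots> < 2 * (ennreal (d/4) + ennreal (d/4))"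
    using add_strict_mono[OF n(1) k] by (intro ennreal_mult_strict_left_mono) auto
  also have "\<dots> = ennreal d" using d
    by (simp flip: ennreal_plus add: numeral_mult_ennreal)
  finally show ?thesis using \<phi>(1,2) that by blast
qed

section \<open>Plancherel for integrable square-integrable functions\<close>

text \<open>A Bochner integral, hence a genuine transform for integrable \<open>g\<close> and the
  default 0 where the integral does not exist. Square-integrable functions enter through integrable
  truncations.\<close>

definition fourier :: "(real \<Rightarrow> complex) \<Rightarrow> real \<Rightarrow> complex" where
  "fourier g t = (\<integral>x. cis (- x * t) * g x \<partial>lborel)"

text \<open>The convolution of \<open>g\<close> with its conjugate reflection. Its value at 0 is the
  squared norm of \<open>g\<close> and its transform is the squared modulus of
  \<open>fourier g\<close>, so Plancherel becomes the recovery of one value from a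
  transform.\<close>

definition autocorr :: "(real \<Rightarrow> complex) \<Rightarrow> real \<Rightarrow> complex" where
  "autocorr g h = (\<integral>v. g (v + h) * cnj (g v) \<partial>lborel)"

lemma measurable_cis [measurable]: "cis \<in> borel_measurable borel"
  by (intro borel_measurable_continuous_onI continuous_intros)

lemma measurable_cnj [measurable]: "cnj \<in> borel_measurable borel"
  by (intro borel_measurable_continuous_onI continuous_intros)

lemma borel_measurable_fourier [measurable]:
  assumes [measurable]: "g \<in> borel_measurable borel"
  shows "fourier g \<in> borel_measurable borel"
  unfolding fourier_def by measurable

lemma integrable_cis_mult:
  assumes "integrable lborel g"
  shows "integrable lborel (\<lambda>x. cis (c * x) * g x)"
  using assms by (rule Bochner_Integration.integrable_bound) (use assms in \<open>auto simp: norm_mult\<close>)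

lemma cmod_fourier_le:
  assumes "integrable lborel g"
  shows "cmod (fourier g t) \<le> (\<integral>x. cmod (g x) \<partial>lborel)"
proof -
  have "cmod (fourier g t) \<le> (\<integral>x. cmod (cis (- x * t) * g x) \<partial>lborel)"
    unfolding fourier_def by (rule integral_norm_bound)
  then show ?thesis by (simp add: norm_mult)
qed

lemma integral_shift:
  fixes f :: "real \<Rightarrow> 'a :: {banach, second_countable_topology}"
  shows "(\<integral>x. f (x + h) \<partial>lborel) = (\<integral>x. f x \<partial>lborel)"
  using lborel_integral_real_affine[of 1 f h] by (simp add: add.commute)

lemma integrable_shift:
  fixes f :: "real \<Rightarrow> 'a :: {banach, second_countable_topology}"
  assumes "integrable lborel f"
  shows "integrable lborel (\<lambda>x. f (x + h))"
  using lborel_integrable_real_affine[OF assms, of 1 h] by (simp add: add.commute)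

lemma integrable_cmod_power2I:
  fixes f :: "'a \<Rightarrow> complex"
  assumes "f \<in> borel_measurable M" "(\<integral>\<^sup>+x. ennreal ((cmod (f x))\<^sup>2) \<partial>M) < \<infinity>"
  shows "integrable M (\<lambda>x. (cmod (f x))\<^sup>2)"
  using assms by (intro integrableI_nonneg) auto

lemma mult_le_weighted_squares:
  fixes a b e :: real
  assumes "e > 0"
  shows "a * b \<le> a\<^sup>2 / (2 * e) + e * b\<^sup>2 / 2"
proof -
  have "0 \<le> (a - e * b)\<^sup>2 / (2 * e)" using assms by simp
  also have "\<dots> = a\<^sup>2 / (2 * e) + e * b\<^sup>2 / 2 - a * b"
    using assms by (simp add: field_simps power2_eq_square)
  finally show ?thesis by simp
qed

lemma integrable_mult_L2:
  fixes f g :: "'a \<Rightarrow> complex"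
  assumes [measurable]: "f \<in> borel_measurable M" "g \<in> borel_measurable M"
    and "integrable M (\<lambda>x. (cmod (f x))\<^sup>2)" "integrable M (\<lambda>x. (cmod (g x))\<^sup>2)"
  shows "integrable M (\<lambda>x. f x * g x)"
proof (rule Bochner_Integration.integrable_bound)
  show "integrable M (\<lambda>x. (cmod (f x))\<^sup>2 / 2 + (cmod (g x))\<^sup>2 / 2)" using assms by simp
  show "AE x in M. norm (f x * g x) \<le> norm ((cmod (f x))\<^sup>2 / 2 + (cmod (g x))\<^sup>2 / 2)"
    using mult_le_weighted_squares[of 1 "cmod (f x)" "cmod (g x)" for x] by (auto simp: norm_mult)
qed auto

section \<open>Autocorrelation of an integrable and square-integrable function\<close>

context
  fixes g :: "real \<Rightarrow> complex"
  assumes integrable: "integrable lborel g"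
    and square_integrable: "integrable lborel (\<lambda>x. (cmod (g x))\<^sup>2)"
begin

lemma measurable_g [measurable]: "g \<in> borel_measurable borel"
  using borel_measurable_integrable[OF integrable] by simp

lemma autocorr_0: "autocorr g 0 = complex_of_real (\<integral>x. (cmod (g x))\<^sup>2 \<partial>lborel)"
  unfolding autocorr_def by (simp flip: integral_complex_of_real complex_norm_square)

text \<open>AM-GM in place of Cauchy-Schwarz loses nothing here, since a translate has the same norm
  as \<open>g\<close>. The bound is uniform in \<open>h\<close> and serves as majorant in the
  Gaussian average.\<close>

lemma cmod_autocorr_le: "cmod (autocorr g h) \<le> (\<integral>x. (cmod (g x))\<^sup>2 \<partial>lborel)"
proof -
  have sh: "integrable lborel (\<lambda>v. (cmod (g (v + h)))\<^sup>2)"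
    by (rule integrable_shift[OF square_integrable])
  have "cmod (autocorr g h) \<le> (\<integral>v. cmod (g (v + h) * cnj (g v)) \<partial>lborel)"
    unfolding autocorr_def by (rule integral_norm_bound)
  also have "\<dots> \<le> (\<integral>v. (cmod (g (v + h)))\<^sup>2 / 2 + (cmod (g v))\<^sup>2 / 2 \<partial>lborel)"
  proof (rule integral_mono)
    show "integrable lborel (\<lambda>v. cmod (g (v + h) * cnj (g v)))"
      using sh square_integrable by (intro integrable_norm integrable_mult_L2) auto
    show "cmod (g (v + h) * cnj (g v)) \<le> (cmod (g (v + h)))\<^sup>2 / 2 + (cmod (g v))\<^sup>2 / 2" for v
      using mult_le_weighted_squares[of 1 "cmod (g (v + h))" "cmod (g v)"] by (simp add: norm_mult)
  qed (use sh square_integrable in simp)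
  also have "\<dots> = (\<integral>x. (cmod (g x))\<^sup>2 \<partial>lborel)"
    using sh square_integrable integral_shift[of "\<lambda>v. (cmod (g v))\<^sup>2" h] by simp
  finally show ?thesis .
qed

text \<open>Translation is continuous in L2: \<open>g\<close> is replaced by a bounded continuous
  \<open>\<phi>\<close>, whose translates converge pointwise with majorant
  \<open>2 * B * cmod (g v)\<close>, and the remainder \<open>r\<close> has the same small norm
  before and after translation.\<close>

lemma autocorr_tendsto_0:
  assumes h: "h \<longlonglongrightarrow> 0"
  shows "(\<lambda>n. autocorr g (h n)) \<longlonglongrightarrow> autocorr g 0"
proof (rule tendstoI)
  fix e :: real assume e: "e > 0"
  define K where "K = (\<integral>x. (cmod (g x))\<^sup>2 \<partial>lborel)"
  have K: "K \<ge> 0" by (simp add: K_def)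
  \<comment> \<open>The budget is \<open>e/4\<close> for \<open>\<eta> * K\<close>,
    \<open>e/4\<close> for \<open>D / \<eta>\<close>, which dictates the accuracy
    \<open>\<eta> * e / 4\<close> of the approximation, and \<open>e/2\<close> for \<open>T\<close>.
    Dividing by \<open>K + 1\<close> covers the case \<open>K = 0\<close>.\<close>
  define \<eta> where "\<eta> = e / (4 * (K + 1))"
  have \<eta>: "\<eta> > 0" "\<eta> * K \<le> e / 4" using e K by (auto simp: \<eta>_def field_simps)
  have fin: "(\<integral>\<^sup>+x. ennreal ((cmod (g x))\<^sup>2) \<partial>lborel) < \<infinity>"
    using square_integrable by (simp add: nn_integral_eq_integral)
  obtain \<phi> B where cont: "continuous_on UNIV \<phi>" and B: "\<And>x. cmod (\<phi> x) \<le> B"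
    and approx: "(\<integral>\<^sup>+x. ennreal ((cmod (g x - \<phi> x))\<^sup>2) \<partial>lborel) < ennreal (\<eta> * e / 4)"
    by (rule L2_approx_continuous[OF measurable_g fin, of "\<eta> * e / 4"]) (use e \<eta> in auto)
  have [measurable]: "\<phi> \<in> borel_measurable borel"
    using cont by (rule borel_measurable_continuous_onI)
  define r where "r x = g x - \<phi> x" for x
  have [measurable]: "r \<in> borel_measurable borel" unfolding r_def by measurable
  have r_int: "integrable lborel (\<lambda>x. (cmod (r x))\<^sup>2)"
    using order.strict_trans[OF approx ennreal_less_top] unfolding r_def
    by (intro integrable_cmod_power2I) auto
  define D where "D = (\<integral>x. (cmod (r x))\<^sup>2 \<partial>lborel)"
  have D: "D < \<eta> * e / 4"
    using approx r_int e \<eta> unfolding D_def r_def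
    by (simp add: nn_integral_eq_integral ennreal_less_iff)
  define T where "T h = (\<integral>v. cmod (\<phi> (v + h) - \<phi> v) * cmod (g v) \<partial>lborel)" for h
  have T_le: "cmod (\<phi> (v + k) - \<phi> v) * cmod (g v) \<le> 2 * B * cmod (g v)" for v k
    using norm_triangle_ineq4[of "\<phi> (v + k)" "\<phi> v"] B[of v] B[of "v + k"]
    by (intro mult_right_mono) auto
  have T_int: "integrable lborel (\<lambda>v. cmod (\<phi> (v + k) - \<phi> v) * cmod (g v))" for k
    by (rule Bochner_Integration.integrable_bound[where f="\<lambda>v. 2 * B * cmod (g v)"])
      (use T_le[of _ k] integrable order.trans[OF T_le abs_ge_self] in auto)
  have "(\<lambda>n. T (h n)) \<longlonglongrightarrow> (\<integral>v. 0 \<partial>(lborel :: real measure))"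
    unfolding T_def
  proof (rule integral_dominated_convergence[where w="\<lambda>v. 2 * B * cmod (g v)"])
    show "AE v in lborel. (\<lambda>n. cmod (\<phi> (v + h n) - \<phi> v) * cmod (g v)) \<longlonglongrightarrow> 0"
    proof (rule AE_I2)
      fix v
      have "(\<lambda>n. v + h n) \<longlonglongrightarrow> v + 0" by (intro tendsto_intros h)
      then have "(\<lambda>n. \<phi> (v + h n)) \<longlonglongrightarrow> \<phi> (v + 0)"
        by (intro continuous_on_tendsto_compose[OF cont]) auto
      then have "(\<lambda>n. cmod (\<phi> (v + h n) - \<phi> v) * cmod (g v)) \<longlonglongrightarrow> cmod (\<phi> (v + 0) - \<phi> v) * cmod (g v)"
        by (intro tendsto_intros)
      then show "(\<lambda>n. cmod (\<phi> (v + h n) - \<phi> v) * cmod (g v)) \<longlonglongrightarrow> 0" by simp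
    qed
    show "AE v in lborel. norm (cmod (\<phi> (v + h n) - \<phi> v) * cmod (g v)) \<le> 2 * B * cmod (g v)" for n
      using T_le by (intro AE_I2) simp
  qed (use integrable in auto)
  then have "\<forall>\<^sub>F n in sequentially. T (h n) < e / 2"
    using e by (intro order_tendstoD(2)) auto
  then show "\<forall>\<^sub>F n in sequentially. dist (autocorr g (h n)) (autocorr g 0) < e"
  proof eventually_elim
    fix n assume Tn: "T (h n) < e / 2"
    define k where "k = h n"
    have sh: "integrable lborel (\<lambda>v. (cmod (r (v + k)))\<^sup>2)" by (rule integrable_shift[OF r_int])
    have gsh: "integrable lborel (\<lambda>v. (cmod (g (v + k)))\<^sup>2)" by (rule integrable_shift[OF square_integrable])
    have int1: "integrable lborel (\<lambda>v. g (v + k) * cnj (g v))"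
      and int2: "integrable lborel (\<lambda>v. g v * cnj (g v))"
      using gsh square_integrable by (auto intro!: integrable_mult_L2)
    have "dist (autocorr g k) (autocorr g 0) = cmod (\<integral>v. g (v + k) * cnj (g v) - g v * cnj (g v) \<partial>lborel)"
      using int1 int2 by (simp add: autocorr_def dist_norm)
    also have "\<dots> \<le> (\<integral>v. cmod (g (v + k) * cnj (g v) - g v * cnj (g v)) \<partial>lborel)"
      by (rule integral_norm_bound)
    also have "\<dots> \<le> (\<integral>v. (cmod (r (v + k)))\<^sup>2 / (2 * \<eta>) + (cmod (r v))\<^sup>2 / (2 * \<eta>) + \<eta> * (cmod (g v))\<^sup>2
        + cmod (\<phi> (v + k) - \<phi> v) * cmod (g v) \<partial>lborel)"
    proof (rule integral_mono)
      fix v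
      have "cmod (g (v + k) * cnj (g v) - g v * cnj (g v)) = cmod (g (v + k) - g v) * cmod (g v)"
        by (metis complex_mod_cnj left_diff_distrib norm_mult)
      also have "g (v + k) - g v = r (v + k) + (\<phi> (v + k) - \<phi> v) - r v" by (simp add: r_def)
      also have "cmod (r (v + k) + (\<phi> (v + k) - \<phi> v) - r v)
          \<le> cmod (r (v + k)) + cmod (\<phi> (v + k) - \<phi> v) + cmod (r v)"
        by (meson norm_triangle_ineq norm_triangle_ineq4 add_right_mono order_trans)
      finally have "cmod (g (v + k) * cnj (g v) - g v * cnj (g v))
          \<le> cmod (r (v + k)) * cmod (g v) + cmod (\<phi> (v + k) - \<phi> v) * cmod (g v) + cmod (r v) * cmod (g v)"
        by (simp add: mult_right_mono distrib_right)
      then show "cmod (g (v + k) * cnj (g v) - g v * cnj (g v))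
        \<le> (cmod (r (v + k)))\<^sup>2 / (2 * \<eta>) + (cmod (r v))\<^sup>2 / (2 * \<eta>) + \<eta> * (cmod (g v))\<^sup>2
          + cmod (\<phi> (v + k) - \<phi> v) * cmod (g v)"
        using mult_le_weighted_squares[OF \<eta>(1), of "cmod (r (v + k))" "cmod (g v)"]
          mult_le_weighted_squares[OF \<eta>(1), of "cmod (r v)" "cmod (g v)"] by linarith
    qed (use int1 int2 sh r_int square_integrable T_int in auto)
    also have "\<dots> = D / (2 * \<eta>) + D / (2 * \<eta>) + \<eta> * K + T k"
      using sh r_int square_integrable T_int integral_shift[of "\<lambda>v. (cmod (r v))\<^sup>2" k]
      by (simp add: D_def K_def T_def)
    also have "\<dots> = D / \<eta> + \<eta> * K + T k" using \<eta> by (simp add: field_simps)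
    also have "\<dots> < e / 4 + e / 4 + e / 2"
      using D \<eta> Tn by (intro add_less_le_mono add_le_less_mono) (auto simp: k_def field_simps)
    finally show "dist (autocorr g (h n)) (autocorr g 0) < e" by (simp add: k_def)
  qed
qed

text \<open>By translation invariance the modulus integrates over \<open>h\<close> to the L1 norm of
  \<open>g\<close> times \<open>cmod (g v)\<close>, which is integrable in \<open>v\<close>. The
  case \<open>t = 0\<close> also yields integrability of \<open>autocorr g\<close>.\<close>

lemma integrable_autocorr_kernel:
  "integrable (lborel \<Otimes>\<^sub>M lborel) (\<lambda>(v, h). cis (- h * t) * (g (v + h) * cnj (g v)))"
proof (rule lborel_pair.Fubini_integrable)
  have eq: "(\<integral>h. norm (case (v, h) of (v, h) \<Rightarrow> cis (- h * t) * (g (v + h) * cnj (g v))) \<partial>lborel)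
      = (\<integral>h. cmod (g h) \<partial>lborel) * cmod (g v)" for v
    using integral_shift[of "\<lambda>h. cmod (g h)" v] by (simp add: norm_mult add.commute)
  show "integrable lborel (\<lambda>v. \<integral>h. norm (case (v, h) of (v, h) \<Rightarrow> cis (- h * t) * (g (v + h) * cnj (g v))) \<partial>lborel)"
    unfolding eq using integrable by simp
  show "AE v in lborel. integrable lborel (\<lambda>h. case (v, h) of (v, h) \<Rightarrow> cis (- h * t) * (g (v + h) * cnj (g v)))"
  proof (rule AE_I2)
    fix v
    have "integrable lborel (\<lambda>h. cis ((-t) * h) * (g (h + v) * cnj (g v)))"
      using integrable_shift[OF integrable, of v] by (intro integrable_cis_mult) auto
    then show "integrable lborel (\<lambda>h. case (v, h) of (v, h) \<Rightarrow> cis (- h * t) * (g (v + h) * cnj (g v)))"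
      by (simp add: mult.commute add.commute)
  qed
qed measurable

lemma integrable_autocorr: "integrable lborel (autocorr g)"
  using lborel_pair.integrable_snd[OF integrable_autocorr_kernel[of 0]]
  by (simp add: autocorr_def[abs_def])

text \<open>After Fubini, writing \<open>cis (- h * t)\<close> as
  \<open>cis (- (h + v) * t) * cis (v * t)\<close> separates the shifted variable from
  \<open>v\<close>, and the double integral splits into \<open>fourier g t\<close> and its
  conjugate.\<close>

lemma fourier_autocorr: "fourier (autocorr g) t = complex_of_real ((cmod (fourier g t))\<^sup>2)"
proof -
  have "fourier (autocorr g) t = (\<integral>h. (\<integral>v. cis (- h * t) * (g (v + h) * cnj (g v)) \<partial>lborel) \<partial>lborel)"
    by (simp add: fourier_def autocorr_def)
  also have "\<dots> = (\<integral>v. (\<integral>h. cis (- h * t) * (g (v + h) * cnj (g v)) \<partial>lborel) \<partial>lborel)"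
    by (rule lborel_pair.Fubini_integral[OF integrable_autocorr_kernel])
  also have "\<dots> = (\<integral>v. fourier g t * cnj (cis (- v * t) * g v) \<partial>lborel)"
  proof (rule Bochner_Integration.integral_cong[OF refl])
    fix v
    have "(\<integral>h. cis (- h * t) * (g (v + h) * cnj (g v)) \<partial>lborel)
        = (\<integral>h. cis (- (h + v) * t) * g (h + v) * (cis (v * t) * cnj (g v)) \<partial>lborel)"
    proof (rule Bochner_Integration.integral_cong[OF refl])
      fix h
      have "cis (- h * t) = cis (- (h + v) * t) * cis (v * t)" by (simp add: cis_mult algebra_simps)
      then show "cis (- h * t) * (g (v + h) * cnj (g v))
          = cis (- (h + v) * t) * g (h + v) * (cis (v * t) * cnj (g v))"
        by (simp add: add.commute mult_ac)
    qed
    also have "\<dots> = fourier g t * (cis (v * t) * cnj (g v))"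
      using integral_shift[of "\<lambda>h. cis (- h * t) * g h" v] by (simp add: fourier_def)
    finally show "(\<integral>h. cis (- h * t) * (g (v + h) * cnj (g v)) \<partial>lborel)
        = fourier g t * cnj (cis (- v * t) * g v)"
      by (simp add: cis_cnj)
  qed
  also have "\<dots> = fourier g t * cnj (fourier g t)"
    unfolding fourier_def[of g t] by (simp del: complex_cnj_mult)
  finally show ?thesis by (simp only: complex_norm_square)
qed

end

text \<open>The kernel \<open>cis (- h * t)\<close> is symmetric in its variables, so Fubini moves
  the transform from one factor to the other. With a Gaussian as \<open>g\<close>, a weighted
  integral of \<open>fourier f\<close> becomes an average of \<open>f\<close>, and no inversion
  theorem is involved.\<close>

lemma fourier_multiplication_formula:
  assumes f: "integrable lborel f" and g: "integrable lborel g"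
  shows "(\<integral>t. fourier f t * g t \<partial>lborel) = (\<integral>h. f h * fourier g h \<partial>lborel)"
proof -
  have [measurable]: "f \<in> borel_measurable borel" "g \<in> borel_measurable borel"
    using f g borel_measurable_integrable by auto
  have int: "integrable (lborel \<Otimes>\<^sub>M lborel) (\<lambda>(h, t). cis (- h * t) * (f h * g t))"
  proof (rule lborel_pair.Fubini_integrable)
    show "integrable lborel (\<lambda>h. \<integral>t. norm (case (h, t) of (h, t) \<Rightarrow> cis (- h * t) * (f h * g t)) \<partial>lborel)"
      using f by (simp add: norm_mult)
    show "AE h in lborel. integrable lborel (\<lambda>t. case (h, t) of (h, t) \<Rightarrow> cis (- h * t) * (f h * g t))"
    proof (rule AE_I2)
      fix h
      have "integrable lborel (\<lambda>t. cis ((-h) * t) * (f h * g t))"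
        using g by (intro integrable_cis_mult) auto
      then show "integrable lborel (\<lambda>t. case (h, t) of (h, t) \<Rightarrow> cis (- h * t) * (f h * g t))" by simp
    qed
  qed measurable
  have "(\<integral>t. fourier f t * g t \<partial>lborel) = (\<integral>t. (\<integral>h. cis (- h * t) * (f h * g t) \<partial>lborel) \<partial>lborel)"
    by (simp add: fourier_def flip: mult.assoc)
  also have "\<dots> = (\<integral>h. (\<integral>t. cis (- h * t) * (f h * g t) \<partial>lborel) \<partial>lborel)"
    by (rule lborel_pair.Fubini_integral[OF int])
  also have "\<dots> = (\<integral>h. f h * fourier g h \<partial>lborel)"
    by (simp add: fourier_def mult_ac)
  finally show ?thesis .
qed

text \<open>The substitution \<open>t = s * x\<close> reduces the transform to the characteristic
  function of the standard normal law. The right-hand side is 2\<pi> times the normal density of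
  standard deviation \<open>1/s\<close>, an approximate identity at 0 as \<open>s\<close>
  grows.\<close>

lemma fourier_gaussian:
  assumes s: "s > 0"
  shows "integrable lborel (\<lambda>t. complex_of_real (exp (- t\<^sup>2 / (2 * s\<^sup>2))))"
    and "fourier (\<lambda>t. complex_of_real (exp (- t\<^sup>2 / (2 * s\<^sup>2)))) h
      = complex_of_real (2 * pi * s * std_normal_density (s * h))"
proof -
  have eq: "exp (- t\<^sup>2 / (2 * s\<^sup>2)) = s * sqrt (2 * pi) * normal_density 0 s t" for t
    using s by (simp add: normal_density_def real_sqrt_mult)
  show "integrable lborel (\<lambda>t. complex_of_real (exp (- t\<^sup>2 / (2 * s\<^sup>2))))"
    unfolding eq by (intro integrable_of_real integrable_mult_right) (use s in simp)
  have "fourier (\<lambda>t. complex_of_real (exp (- t\<^sup>2 / (2 * s\<^sup>2)))) h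
      = s *\<^sub>R (\<integral>x. cis (- (s * x) * h) * complex_of_real (exp (- (s * x)\<^sup>2 / (2 * s\<^sup>2))) \<partial>lborel)"
    unfolding fourier_def using s by (subst lborel_integral_real_affine[of s _ 0]) auto
  also have "\<dots> = s *\<^sub>R (\<integral>x. complex_of_real (sqrt (2 * pi)) * (std_normal_density x *\<^sub>R iexp ((- s * h) * x)) \<partial>lborel)"
    using s by (intro arg_cong2[of _ _ _ _ scaleR] refl Bochner_Integration.integral_cong)
      (simp add: std_normal_density_def cis_conv_exp scaleR_conv_of_real power_mult_distrib mult_ac)
  also have "\<dots> = s *\<^sub>R (complex_of_real (sqrt (2 * pi)) * char std_normal_distribution (- s * h))"
    unfolding char_def by (subst integral_density) (auto simp: scaleR_conv_of_real)
  also have "\<dots> = complex_of_real (s * sqrt (2 * pi) * exp (- (s * h)\<^sup>2 / 2))"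
    by (simp add: char_std_normal_distribution scaleR_conv_of_real)
  also have "s * sqrt (2 * pi) * exp (- (s * h)\<^sup>2 / 2) = 2 * pi * s * std_normal_density (s * h)"
    by (simp add: std_normal_density_def real_div_sqrt field_simps flip: real_sqrt_mult)
  finally show "fourier (\<lambda>t. complex_of_real (exp (- t\<^sup>2 / (2 * s\<^sup>2)))) h
      = complex_of_real (2 * pi * s * std_normal_density (s * h))" .
qed

text \<open>The autocorrelation has Fourier transform \<open>|fourier g|\<^sup>2\<close>; pairing it with a widening Gaussian
  recovers its value at 0, by continuity of translation in \<open>L\<^sup>2\<close>.\<close>
theorem plancherel_L1_L2:
  assumes g: "integrable lborel g" and g2: "integrable lborel (\<lambda>x. (cmod (g x))\<^sup>2)"
  shows "(\<integral>\<^sup>+t. ennreal ((cmod (fourier g t))\<^sup>2) \<partial>lborel)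
    = ennreal (2 * pi) * (\<integral>\<^sup>+x. ennreal ((cmod (g x))\<^sup>2) \<partial>lborel)"
proof -
  have [measurable]: "g \<in> borel_measurable borel" using borel_measurable_integrable[OF g] by simp
  \<comment> \<open>Gaussians increasing to 1: monotone convergence recovers the integral of the
    squared modulus of \<open>fourier g\<close> without knowing in advance that it is finite.
    \<open>Suc n\<close> keeps the width positive.\<close>
  define w where "w n t = exp (- t\<^sup>2 / (2 * (real (Suc n))\<^sup>2))" for n t
  have w0: "w n t > 0" for n t by (simp add: w_def)
  have [measurable]: "w n \<in> borel_measurable borel" for n unfolding w_def by measurable
  have wint: "integrable lborel (w n)" for n
    using integrable_Re[OF fourier_gaussian(1)[of "real (Suc n)"]] unfolding w_def by simp
  define K where "K = (\<integral>x. (cmod (g x))\<^sup>2 \<partial>lborel)"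
  have key: "(\<integral>t. (cmod (fourier g t))\<^sup>2 * w n t \<partial>lborel)
      = 2 * pi * Re (\<integral>z. std_normal_density z *\<^sub>R autocorr g (z / real (Suc n)) \<partial>lborel)" for n
  proof -
    define s where "s = real (Suc n)"
    have s: "s > 0" by (simp add: s_def)
    have "complex_of_real (\<integral>t. (cmod (fourier g t))\<^sup>2 * w n t \<partial>lborel)
        = (\<integral>t. fourier (autocorr g) t * complex_of_real (exp (- t\<^sup>2 / (2 * s\<^sup>2))) \<partial>lborel)"
      by (simp add: fourier_autocorr[OF g g2] w_def s_def flip: integral_complex_of_real)
    also have "\<dots> = (\<integral>h. autocorr g h * complex_of_real (2 * pi * s * std_normal_density (s * h)) \<partial>lborel)"
      using fourier_multiplication_formula[OF integrable_autocorr[OF g g2] fourier_gaussian(1)[OF s]]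
      by (simp only: fourier_gaussian(2)[OF s])
    \<comment> \<open>Rescaling by \<open>h = z / s\<close> leaves one fixed density and moves the
      concentration into the argument of \<open>autocorr g\<close>, which prepares dominated
      convergence.\<close>
    also have "\<dots> = (1 / s) *\<^sub>R (\<integral>z. autocorr g (z / s) * complex_of_real (2 * pi * s * std_normal_density z) \<partial>lborel)"
      using s by (subst lborel_integral_real_affine[of "1/s" _ 0]) auto
    also have "\<dots> = (1 / s) *\<^sub>R (\<integral>z. complex_of_real (2 * pi * s) * (std_normal_density z *\<^sub>R autocorr g (z / s)) \<partial>lborel)"
      by (simp add: scaleR_conv_of_real mult_ac)
    also have "\<dots> = complex_of_real (2 * pi) * (\<integral>z. std_normal_density z *\<^sub>R autocorr g (z / s) \<partial>lborel)"
      using s by (simp add: scaleR_conv_of_real field_simps)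
    finally have "Re (complex_of_real (\<integral>t. (cmod (fourier g t))\<^sup>2 * w n t \<partial>lborel))
      = Re (complex_of_real (2 * pi) * (\<integral>z. std_normal_density z *\<^sub>R autocorr g (z / s) \<partial>lborel))"
      by (rule arg_cong)
    then show ?thesis unfolding s_def by (simp del: of_nat_Suc of_real_mult)
  qed
  have [measurable]: "autocorr g \<in> borel_measurable borel"
    using borel_measurable_integrable[OF integrable_autocorr[OF g g2]] by simp
  have "(\<lambda>n. \<integral>z. std_normal_density z *\<^sub>R autocorr g (z / real (Suc n)) \<partial>lborel)
      \<longlonglongrightarrow> (\<integral>z. std_normal_density z *\<^sub>R autocorr g 0 \<partial>lborel)"
  proof (rule integral_dominated_convergence[where w="\<lambda>z. std_normal_density z * K"])
    show "AE z in lborel. (\<lambda>n. std_normal_density z *\<^sub>R autocorr g (z / real (Suc n)))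
        \<longlonglongrightarrow> std_normal_density z *\<^sub>R autocorr g 0"
    proof (intro AE_I2 tendsto_intros autocorr_tendsto_0[OF g g2])
      fix z :: real
      show "(\<lambda>n. z / real (Suc n)) \<longlonglongrightarrow> 0"
        using lim_const_over_n[of z] by (rule LIMSEQ_Suc)
    qed
    show "AE z in lborel. norm (std_normal_density z *\<^sub>R autocorr g (z / real (Suc n)))
        \<le> std_normal_density z * K" for n
      using cmod_autocorr_le[OF g g2] by (auto intro!: mult_left_mono simp: K_def)
  qed auto
  also have "(\<integral>z. std_normal_density z *\<^sub>R autocorr g 0 \<partial>lborel) = complex_of_real K"
    by (simp add: autocorr_0[OF g g2] K_def)
  finally have "(\<lambda>n. \<integral>t. (cmod (fourier g t))\<^sup>2 * w n t \<partial>lborel) \<longlonglongrightarrow> 2 * pi * Re (complex_of_real K)"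
    unfolding key by (intro tendsto_intros)
  then have lim1: "(\<lambda>n. ennreal (\<integral>t. (cmod (fourier g t))\<^sup>2 * w n t \<partial>lborel)) \<longlonglongrightarrow> ennreal (2 * pi * K)"
    by (intro tendsto_ennrealI) simp
  \<comment> \<open>\<open>fourier g\<close> is bounded by the L1 norm of \<open>g\<close>, so the
    Gaussian weight makes the integral finite. This links the real-valued integrals of
    \<open>key\<close> with the extended ones.\<close>
  have int: "integrable lborel (\<lambda>t. (cmod (fourier g t))\<^sup>2 * w n t)" for n
  proof (rule Bochner_Integration.integrable_bound)
    show "integrable lborel (\<lambda>t. (\<integral>x. cmod (g x) \<partial>lborel)\<^sup>2 * w n t)" using wint by simp
    show "AE t in lborel. norm ((cmod (fourier g t))\<^sup>2 * w n t) \<le> norm ((\<integral>x. cmod (g x) \<partial>lborel)\<^sup>2 * w n t)"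
      using cmod_fourier_le[OF g] w0[of n]
      by (intro AE_I2) (auto simp: abs_mult less_imp_le intro!: mult_right_mono power_mono)
  qed measurable
  have "(\<lambda>n. \<integral>\<^sup>+t. ennreal ((cmod (fourier g t))\<^sup>2 * w n t) \<partial>lborel)
      \<longlonglongrightarrow> (\<integral>\<^sup>+t. ennreal ((cmod (fourier g t))\<^sup>2) \<partial>lborel)"
  proof (rule nn_integral_LIMSEQ)
    have "w n t \<le> w m t" if "n \<le> m" for n m t
      using that unfolding w_def by (auto intro!: divide_left_mono mult_left_mono power_mono)
    then show "incseq (\<lambda>n t. ennreal ((cmod (fourier g t))\<^sup>2 * w n t))"
      by (intro monoI le_funI ennreal_leI mult_left_mono) auto
    show "(\<lambda>n. ennreal ((cmod (fourier g t))\<^sup>2 * w n t)) \<longlonglongrightarrow> ennreal ((cmod (fourier g t))\<^sup>2)" for t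
    proof -
      have "(\<lambda>n. w n t) \<longlonglongrightarrow> 1" unfolding w_def by real_asymp
      then have "(\<lambda>n. ennreal ((cmod (fourier g t))\<^sup>2 * w n t)) \<longlonglongrightarrow> ennreal ((cmod (fourier g t))\<^sup>2 * 1)"
        by (intro tendsto_intros)
      then show ?thesis by simp
    qed
  qed measurable
  moreover have "(\<integral>\<^sup>+t. ennreal ((cmod (fourier g t))\<^sup>2 * w n t) \<partial>lborel)
      = ennreal (\<integral>t. (cmod (fourier g t))\<^sup>2 * w n t \<partial>lborel)" for n
    using int by (rule nn_integral_eq_integral) (auto simp: less_imp_le[OF w0])
  ultimately have "(\<integral>\<^sup>+t. ennreal ((cmod (fourier g t))\<^sup>2) \<partial>lborel) = ennreal (2 * pi * K)"
    using lim1 LIMSEQ_unique by simp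
  also have "\<dots> = ennreal (2 * pi) * ennreal K" by (simp add: ennreal_mult' K_def)
  finally show ?thesis using g2 by (simp add: nn_integral_eq_integral K_def)
qed

section \<open>Power substitution and the integral of \<open>sin\<^sup>2 y / y\<^sup>\<gamma>\<close>\<close>

lemma powr_has_real_derivative:
  assumes "(x::real) > 0"
  shows "((\<lambda>x. x powr b) has_real_derivative b * x powr (b - 1)) (at x)"
  using assms by (auto intro!: derivative_eq_intros simp: field_simps powr_diff)

text \<open>On \<open>{l n..r n}\<close>, away from a possible singularity of
  \<open>x powr (b - 1)\<close> at 0, the change of variables on a compact interval applies;
  monotone convergence then exhausts the half line on both sides. Indicator functions are enough to
  identify two measures.\<close>

lemma nn_integral_powr_substitution_indicator:
  assumes b: "b > (0::real)" and [measurable]: "A \<in> sets borel"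
  shows "(\<integral>\<^sup>+w. ennreal (indicator A w) * indicator {0<..} w \<partial>lborel)
    = (\<integral>\<^sup>+x. ennreal (indicator A (x powr b) * (b * x powr (b - 1))) * indicator {0<..} x \<partial>lborel)"
proof -
  define l where "l n = 1 / real (Suc n)" for n
  define r where "r n = real (Suc n)" for n
  have l0: "l n > 0" and lr: "l n \<le> r n" for n by (auto simp: l_def r_def field_simps)
  have lim: "l \<longlonglongrightarrow> 0" unfolding l_def by real_asymp
  have lr_mono: "l m \<le> l n" "r n \<le> r m" if "n \<le> m" for n m
    using that by (auto simp: l_def r_def intro!: divide_left_mono)
  have ev: "\<forall>\<^sub>F n in sequentially. l n \<le> x \<and> x \<le> r n" if x: "x > 0" for x
  proof -
    have "\<forall>\<^sub>F n in sequentially. l n < x" using lim x by (rule order_tendstoD)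
    moreover have "\<forall>\<^sub>F n in sequentially. x \<le> r n" unfolding r_def by real_asymp
    ultimately show ?thesis by eventually_elim auto
  qed
  have "(\<lambda>n. \<integral>\<^sup>+w. ennreal (indicator A w) * indicator {l n powr b..r n powr b} w \<partial>lborel)
      \<longlonglongrightarrow> (\<integral>\<^sup>+w. ennreal (indicator A w) * indicator {0<..} w \<partial>lborel)"
  proof (rule nn_integral_LIMSEQ)
    have "{l n powr b..r n powr b} \<subseteq> {l m powr b..r m powr b}" if "n \<le> m" for n m
    proof -
      have "l m powr b \<le> l n powr b" "r n powr b \<le> r m powr b"
        using lr_mono[OF that] less_imp_le[OF l0[of m]] b by (auto intro!: powr_mono2 simp: r_def)
      then show ?thesis by (simp add: atLeastatMost_subset_iff)
    qed
    then show "incseq (\<lambda>n w. ennreal (indicator A w) * indicator {l n powr b..r n powr b} w)"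
      by (intro monoI le_funI mult_left_mono indicator_leI) (blast, simp)
    show "(\<lambda>n. ennreal (indicator A w) * indicator {l n powr b..r n powr b} w)
      \<longlonglongrightarrow> ennreal (indicator A w) * indicator {0<..} w" for w
    proof (cases "w > 0")
      case True
      have "\<forall>\<^sub>F n in sequentially. l n \<le> w powr (1/b) \<and> w powr (1/b) \<le> r n" using True by (intro ev) auto
      then have "\<forall>\<^sub>F n in sequentially. ennreal (indicator A w) * indicator {l n powr b..r n powr b} w
        = ennreal (indicator A w) * indicator {0<..} w"
      proof eventually_elim
        case (elim n)
        have "l n powr b \<le> (w powr (1/b)) powr b" "(w powr (1/b)) powr b \<le> r n powr b"
          using elim b l0[of n] by (auto intro!: powr_mono2)
        then show ?case using True b by (simp add: powr_powr)
      qed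
      then show ?thesis by (rule tendsto_eventually)
    next
      case False
      have "0 < l n powr b" for n using l0[of n] by simp
      then have "w \<notin> {l n powr b..r n powr b}" for n using False by (meson atLeastAtMost_iff leD le_less_trans not_less order_less_le_trans)
      then show ?thesis using False by simp
    qed
  qed measurable
  moreover have "(\<lambda>n. \<integral>\<^sup>+x. ennreal (indicator A (x powr b) * (b * x powr (b - 1))) * indicator {l n..r n} x \<partial>lborel)
      \<longlonglongrightarrow> (\<integral>\<^sup>+x. ennreal (indicator A (x powr b) * (b * x powr (b - 1))) * indicator {0<..} x \<partial>lborel)"
  proof (rule nn_integral_LIMSEQ)
    have "{l n..r n} \<subseteq> {l m..r m}" if "n \<le> m" for n m
      using lr_mono[OF that] by auto
    then show "incseq (\<lambda>n x. ennreal (indicator A (x powr b) * (b * x powr (b - 1))) * indicator {l n..r n} x)"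
      by (intro monoI le_funI mult_left_mono indicator_leI) (blast, simp)
    show "(\<lambda>n. ennreal (indicator A (x powr b) * (b * x powr (b - 1))) * indicator {l n..r n} x)
      \<longlonglongrightarrow> ennreal (indicator A (x powr b) * (b * x powr (b - 1))) * indicator {0<..} x" for x
    proof (cases "x > 0")
      case True
      have "\<forall>\<^sub>F n in sequentially. ennreal (indicator A (x powr b) * (b * x powr (b - 1))) * indicator {l n..r n} x
        = ennreal (indicator A (x powr b) * (b * x powr (b - 1))) * indicator {0<..} x"
        using ev[OF True] by eventually_elim (use True in auto)
      then show ?thesis by (rule tendsto_eventually)
    next
      case False
      then have "x \<notin> {l n..r n}" for n using l0[of n] by auto
      then show ?thesis using False by simp
    qed
  qed measurable
  moreover have "(\<integral>\<^sup>+w. ennreal (indicator A w) * indicator {l n powr b..r n powr b} w \<partial>lborel)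
    = (\<integral>\<^sup>+x. ennreal (indicator A (x powr b) * (b * x powr (b - 1))) * indicator {l n..r n} x \<partial>lborel)" for n
  proof -
    have "(\<integral>\<^sup>+w. ennreal (indicator A w * indicator {l n powr b..r n powr b} w) \<partial>lborel)
      = (\<integral>\<^sup>+x. ennreal (indicator A (x powr b) * (b * x powr (b - 1)) * indicator {l n..r n} x) \<partial>lborel)"
    proof (rule nn_integral_substitution)
      show "((\<lambda>x. x powr b) has_real_derivative b * x powr (b - 1)) (at x)" if "x \<in> {l n..r n}" for x
        using that l0[of n] by (intro powr_has_real_derivative) auto
      show "continuous_on {l n..r n} (\<lambda>x. b * x powr (b - 1))"
        using l0[of n] by (intro continuous_intros) auto
    qed (use b lr in \<open>auto simp: set_borel_measurable_def\<close>)
    moreover have "(\<integral>\<^sup>+w. ennreal (indicator A w) * indicator {l n powr b..r n powr b} w \<partial>lborel)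
      = (\<integral>\<^sup>+w. ennreal (indicator A w * indicator {l n powr b..r n powr b} w) \<partial>lborel)"
      by (intro nn_integral_cong) (auto simp: indicator_def)
    moreover have "(\<integral>\<^sup>+x. ennreal (indicator A (x powr b) * (b * x powr (b - 1)) * indicator {l n..r n} x) \<partial>lborel)
      = (\<integral>\<^sup>+x. ennreal (indicator A (x powr b) * (b * x powr (b - 1))) * indicator {l n..r n} x \<partial>lborel)"
      by (intro nn_integral_cong) (auto simp: indicator_def)
    ultimately show ?thesis by simp
  qed
  ultimately show ?thesis using LIMSEQ_unique by simp
qed

text \<open>Stated for measures, so that both the Lebesgue and the Bochner version of the
  substitution follow.\<close>
lemma distr_powr_lborel:
  assumes b: "b > (0::real)"
  shows "distr (density lborel (\<lambda>x. ennreal (indicator {0<..} x * (b * x powr (b - 1))))) borel (\<lambda>x. x powr b)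
    = density lborel (\<lambda>w. ennreal (indicator {0<..} w))"
proof (rule measure_eqI)
  fix A assume "A \<in> sets (distr (density lborel (\<lambda>x. ennreal (indicator {0<..} x * (b * x powr (b - 1))))) borel (\<lambda>x. x powr b))"
  then have A[measurable]: "A \<in> sets borel" by simp
  have "(\<lambda>x. x powr b) -` A \<in> sets borel"
    using measurable_sets[OF _ A, of "\<lambda>x::real. x powr b" borel] by simp
  then have "emeasure (distr (density lborel (\<lambda>x. ennreal (indicator {0<..} x * (b * x powr (b - 1))))) borel (\<lambda>x. x powr b)) A
    = (\<integral>\<^sup>+x. ennreal (indicator {0<..} x * (b * x powr (b - 1))) * indicator ((\<lambda>x. x powr b) -` A) x \<partial>lborel)"
    by (simp add: emeasure_distr emeasure_density)
  also have "\<dots> = (\<integral>\<^sup>+x. ennreal (indicator A (x powr b) * (b * x powr (b - 1))) * indicator {0<..} x \<partial>lborel)"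
    by (intro nn_integral_cong) (auto simp: indicator_def)
  also have "\<dots> = (\<integral>\<^sup>+w. ennreal (indicator A w) * indicator {0<..} w \<partial>lborel)"
    by (rule nn_integral_powr_substitution_indicator[OF b A, symmetric])
  also have "\<dots> = emeasure (density lborel (\<lambda>w. ennreal (indicator {0<..} w))) A"
    by (simp add: emeasure_density ennreal_indicator mult.commute)
  finally show "emeasure (distr (density lborel (\<lambda>x. ennreal (indicator {0<..} x * (b * x powr (b - 1))))) borel (\<lambda>x. x powr b)) A
    = emeasure (density lborel (\<lambda>w. ennreal (indicator {0<..} w))) A" .
qed simp

lemma nn_integral_powr_substitution:
  assumes b: "b > (0::real)" and [measurable]: "f \<in> borel_measurable borel"
  shows "(\<integral>\<^sup>+w\<in>{0<..}. f w \<partial>lborel) = (\<integral>\<^sup>+x\<in>{0<..}. ennreal (b * x powr (b - 1)) * f (x powr b) \<partial>lborel)"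
proof -
  have "(\<integral>\<^sup>+w\<in>{0<..}. f w \<partial>lborel) = (\<integral>\<^sup>+w. f w \<partial>density lborel (\<lambda>w. ennreal (indicator {0<..} w)))"
    by (simp add: nn_integral_density ennreal_indicator mult.commute)
  also have "\<dots> = (\<integral>\<^sup>+x. ennreal (indicator {0<..} x * (b * x powr (b - 1))) * f (x powr b) \<partial>lborel)"
    by (simp add: nn_integral_density nn_integral_distr flip: distr_powr_lborel[OF b])
  also have "\<dots> = (\<integral>\<^sup>+x\<in>{0<..}. ennreal (b * x powr (b - 1)) * f (x powr b) \<partial>lborel)"
    by (intro nn_integral_cong) (auto simp: indicator_def)
  finally show ?thesis .
qed

text \<open>Obtained from the identity of measures and not from a limit of compact intervals, so it
  covers every measurable \<open>f\<close>, including the default value 0 when \<open>f\<close> is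
  not integrable on the half line.\<close>

lemma integral_powr_substitution:
  fixes f :: "real \<Rightarrow> complex"
  assumes b: "b > 0" and [measurable]: "f \<in> borel_measurable borel"
  shows "(LINT w:{0<..}|lborel. f w) = (LINT x:{0<..}|lborel. (b * x powr (b - 1)) *\<^sub>R f (x powr b))"
proof -
  have "(LINT w:{0<..}|lborel. f w) = (\<integral>w. f w \<partial>density lborel (\<lambda>w. ennreal (indicator {0<..} w)))"
    by (simp add: integral_density set_lebesgue_integral_def)
  also have "\<dots> = (\<integral>x. (indicator {0<..} x * (b * x powr (b - 1))) *\<^sub>R f (x powr b) \<partial>lborel)"
    using b by (simp add: integral_density integral_distr flip: distr_powr_lborel[OF b])
  finally show ?thesis by (simp add: set_lebesgue_integral_def)
qed

text \<open>Euler's integral after the scaling \<open>t = y * s\<close>. It exhibits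
  \<open>y powr - p\<close> as a superposition of exponentials, the form in which powers can be
  handled by an exchange of integrals.\<close>

lemma nn_integral_Gamma_scaled:
  assumes p: "p > (0::real)" and y: "y > 0"
  shows "(\<integral>\<^sup>+s\<in>{0<..}. ennreal (s powr (p - 1) * exp (- (y * s))) \<partial>lborel) = ennreal (Gamma p * y powr - p)"
    (is "?X = _")
proof -
  have "ennreal (Gamma p) = (\<integral>\<^sup>+t. ennreal (indicator {0..} t * t powr (p - 1) / exp t) \<partial>lborel)"
    by (rule Gamma_conv_nn_integral_real[OF p])
  also have "\<dots> = ennreal y * (\<integral>\<^sup>+s. ennreal (indicator {0..} (y * s) * (y * s) powr (p - 1) / exp (y * s)) \<partial>lborel)"
    using y by (subst nn_integral_real_affine[where c=y and t=0]) auto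
  also have "(\<integral>\<^sup>+s. ennreal (indicator {0..} (y * s) * (y * s) powr (p - 1) / exp (y * s)) \<partial>lborel)
      = (\<integral>\<^sup>+s. ennreal (y powr (p - 1)) * (ennreal (s powr (p - 1) * exp (- (y * s))) * indicator {0<..} s) \<partial>lborel)"
  proof (intro nn_integral_cong)
    fix s :: real
    show "ennreal (indicator {0..} (y * s) * (y * s) powr (p - 1) / exp (y * s))
        = ennreal (y powr (p - 1)) * (ennreal (s powr (p - 1) * exp (- (y * s))) * indicator {0<..} s)"
      using y by (cases "s > 0"; cases "s = 0")
        (auto simp: powr_mult exp_minus field_simps zero_le_mult_iff simp flip: ennreal_mult')
  qed
  also have "\<dots> = ennreal (y powr (p - 1)) * ?X" by (intro nn_integral_cmult) auto
  also have "ennreal y * (ennreal (y powr (p - 1)) * ?X) = ennreal (y powr p) * ?X"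
    using y by (simp add: powr_diff flip: mult.assoc ennreal_mult')
  finally have "ennreal (y powr - p) * ennreal (Gamma p) = ennreal (y powr - p) * (ennreal (y powr p) * ?X)" by simp
  also have "\<dots> = ?X" using y by (simp add: powr_minus flip: mult.assoc ennreal_mult')
  finally show ?thesis using p by (simp add: mult.commute flip: ennreal_mult')
qed

text \<open>The Laplace transform of \<open>(sin y)\<^sup>2\<close>, through
  \<open>(sin y)\<^sup>2 = (1 - cos (2 * y)) / 2\<close>. The explicit antiderivative
  \<open>F\<close> vanishes at infinity, which leaves \<open>- F 0\<close>.\<close>

lemma nn_integral_exp_sin_squared:
  assumes s: "s > (0::real)"
  shows "(\<integral>\<^sup>+y\<in>{0<..}. ennreal ((sin y)\<^sup>2 * exp (- (y * s))) \<partial>lborel) = ennreal (2 / (s * (s\<^sup>2 + 4)))"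
proof -
  \<comment> \<open>\<open>exp (- (y * s)) * (2 * sin (2 * y) - s * cos (2 * y)) / (s\<^sup>2 +
    4)\<close> is an antiderivative of \<open>exp (- (y * s)) * cos (2 * y)\<close>;
    \<open>c\<close> adds the factor 1/2 of the half-angle identity.\<close>
  define c where "c = 1 / (2 * (s\<^sup>2 + 4))"
  define F where "F y = - (1 / (2 * s)) * exp (- (y * s))
      - c * (exp (- (y * s)) * (2 * sin (2 * y) - s * cos (2 * y)))" for y
  have s4: "s\<^sup>2 + 4 > 0" by (simp add: add_nonneg_pos)
  have "(\<integral>\<^sup>+y\<in>{0<..}. ennreal ((sin y)\<^sup>2 * exp (- (y * s))) \<partial>lborel)
      = (\<integral>\<^sup>+y. ennreal ((sin y)\<^sup>2 * exp (- (y * s))) * indicator {0..} y \<partial>lborel)"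
    by (intro nn_integral_cong) (auto simp: indicator_def)
  also have "\<dots> = ennreal (0 - F 0)"
  proof (rule nn_integral_FTC_atLeast)
    show "DERIV F y :> (sin y)\<^sup>2 * exp (- (y * s))" for y
    proof -
      have "DERIV F y :> 1 / (2 * s) * s * exp (- (y * s))
          - c * (exp (- (y * s)) * (4 * cos (2 * y) + 2 * s * sin (2 * y))
            - s * exp (- (y * s)) * (2 * sin (2 * y) - s * cos (2 * y)))"
        unfolding F_def by (auto intro!: derivative_eq_intros simp: algebra_simps)
      also have "1 / (2 * s) * s = 1 / 2" using s by simp
      also have "c * (exp (- (y * s)) * (4 * cos (2 * y) + 2 * s * sin (2 * y))
            - s * exp (- (y * s)) * (2 * sin (2 * y) - s * cos (2 * y)))
          = c * (s\<^sup>2 + 4) * (exp (- (y * s)) * cos (2 * y))"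
        by (simp add: algebra_simps power2_eq_square)
      also have "c * (s\<^sup>2 + 4) = 1 / 2" using s4 by (simp add: c_def)
      also have "1 / 2 * exp (- (y * s)) - 1 / 2 * (exp (- (y * s)) * cos (2 * y)) = (sin y)\<^sup>2 * exp (- (y * s))"
        unfolding cos_double_sin by (simp add: algebra_simps)
      finally show ?thesis .
    qed
    have *: "((\<lambda>y. exp (- (y * s))) \<longlongrightarrow> 0) at_top" using s by real_asymp
    have "((\<lambda>y. exp (- (y * s)) * (2 * sin (2 * y) - s * cos (2 * y))) \<longlongrightarrow> 0) at_top"
    proof (rule tendsto_0_le[OF *, of _ "2 + s"], rule always_eventually, rule allI)
      fix y
      have "\<bar>2 * sin (2 * y) - s * cos (2 * y)\<bar> \<le> \<bar>2 * sin (2 * y)\<bar> + \<bar>s * cos (2 * y)\<bar>" by (rule abs_triangle_ineq4)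
      also have "\<dots> \<le> 2 * 1 + s * 1" using s by (intro add_mono) (auto simp: abs_mult intro!: mult_left_mono)
      finally show "norm (exp (- (y * s)) * (2 * sin (2 * y) - s * cos (2 * y))) \<le> norm (exp (- (y * s))) * (2 + s)"
        by (simp add: abs_mult)
    qed
    then have "(F \<longlongrightarrow> - (1 / (2 * s)) * 0 - c * 0) at_top"
      unfolding F_def by (intro tendsto_intros *)
    then show "(F \<longlongrightarrow> 0) at_top" by simp
  qed auto
  also have "0 - F 0 = 2 / (s * (s\<^sup>2 + 4))"
  proof -
    have "s * (s\<^sup>2 + 4) \<noteq> 0" using s s4 by simp
    then show ?thesis using s s4 unfolding F_def c_def by (simp add: divide_simps) (simp add: algebra_simps power2_eq_square)
  qed
  finally show ?thesis .
qed

lemma Gamma_reflection_real: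
  fixes a :: real
  assumes "0 < a" "a < 1"
  shows "Gamma a * Gamma (1 - a) = pi / sin (pi * a)"
proof -
  have "complex_of_real (Gamma a * Gamma (1 - a)) = complex_of_real (pi / sin (pi * a))"
    using Gamma_reflection_complex[of "of_real a"] Gamma_complex_of_real[of a]
      Gamma_complex_of_real[of "1 - a"] sin_of_real[of "pi * a", where 'a=complex] by simp
  then show ?thesis by (simp only: of_real_eq_iff)
qed

text \<open>Both remaining integrals are evaluated by writing a factor as a Gamma integral and exchanging
  the order of integration: \<open>1/(s\<^sup>2 + 4)\<close> here, and \<open>y\<^sup>-\<^sup>g\<close> in the next lemma.\<close>
lemma nn_integral_powr_div_quadratic:
  assumes g: "1 < g" "g \<le> (2::real)"
  shows "(\<integral>\<^sup>+s\<in>{0<..}. ennreal (s powr (g - 1) * (2 / (s * (s\<^sup>2 + 4)))) \<partial>lborel)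
    = ennreal (2 powr (g - 3) * pi / sin (pi * ((g - 1) / 2)))"
proof -
  \<comment> \<open>The Gamma parameter produced by \<open>w = s\<^sup>2\<close>: the measure
    \<open>2 * s powr (g - 2)\<close> ds becomes \<open>w powr (a - 1)\<close> dw. The range of
    \<open>g\<close> puts \<open>a\<close> strictly between 0 and 1, so \<open>Gamma a\<close> and
    \<open>Gamma (1 - a)\<close> both arise from convergent integrals and combine by
    reflection.\<close>
  define a where "a = (g - 1) / 2"
  have a: "0 < a" "a < 1" using g by (auto simp: a_def)
  have inner: "(\<integral>\<^sup>+s\<in>{0<..}. ennreal (2 * s powr (g - 2) * exp (- (z * (s\<^sup>2 + 4)))) \<partial>lborel)
      = ennreal (Gamma a) * ennreal (z powr ((1 - a) - 1) * exp (- (4 * z)))" if z: "z > 0" for z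
  proof -
    have "ennreal (exp (- (4 * z))) * ennreal (Gamma a * z powr - a)
      = (\<integral>\<^sup>+w\<in>{0<..}. ennreal (exp (- (4 * z))) * ennreal (w powr (a - 1) * exp (- (z * w))) \<partial>lborel)"
      unfolding nn_integral_Gamma_scaled[OF a(1) z, symmetric] mult.assoc
      by (rule nn_integral_cmult[symmetric]) measurable
    also have "\<dots> = (\<integral>\<^sup>+s\<in>{0<..}. ennreal (2 * s powr (2 - 1)) * (ennreal (exp (- (4 * z)))
        * ennreal ((s powr 2) powr (a - 1) * exp (- (z * s powr 2)))) \<partial>lborel)"
      using nn_integral_powr_substitution[of 2 "\<lambda>w. ennreal (exp (- (4 * z))) * ennreal (w powr (a - 1) * exp (- (z * w)))"]
      by simp
    also have "\<dots> = (\<integral>\<^sup>+s\<in>{0<..}. ennreal (2 * s powr (g - 2) * exp (- (z * (s\<^sup>2 + 4)))) \<partial>lborel)"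
    proof (intro nn_integral_cong)
      fix s :: real
      show "ennreal (2 * s powr (2 - 1)) * (ennreal (exp (- (4 * z)))
          * ennreal ((s powr 2) powr (a - 1) * exp (- (z * s powr 2)))) * indicator {0<..} s
        = ennreal (2 * s powr (g - 2) * exp (- (z * (s\<^sup>2 + 4)))) * indicator {0<..} s"
      proof (cases "s > 0")
        case True
        have "(2 - 1) + 2 * (a - 1) = g - 2" by (simp add: a_def field_simps)
        then have "s powr (g - 2) = s powr ((2 - 1) + 2 * (a - 1))" by (simp only:)
        also have "\<dots> = s powr (2 - 1) * (s powr 2) powr (a - 1)" by (simp only: powr_add powr_powr)
        finally have "s powr (g - 2) = s powr (2 - 1) * (s powr 2) powr (a - 1)" .
        moreover have "exp (- (z * (s\<^sup>2 + 4))) = exp (- (4 * z)) * exp (- (z * s powr 2))"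
          using True by (simp add: algebra_simps flip: exp_add)
        ultimately show ?thesis using True
          by (simp add: mult_ac flip: ennreal_mult')
      qed simp
    qed
    finally show ?thesis using a(1) by (simp add: mult_ac flip: ennreal_mult')
  qed
  have "(\<integral>\<^sup>+s\<in>{0<..}. ennreal (s powr (g - 1) * (2 / (s * (s\<^sup>2 + 4)))) \<partial>lborel)
      = (\<integral>\<^sup>+s. (\<integral>\<^sup>+z. ennreal (2 * s powr (g - 2) * exp (- (z * (s\<^sup>2 + 4)))) * indicator {0<..} s * indicator {0<..} z \<partial>lborel) \<partial>lborel)"
  proof (intro nn_integral_cong)
    fix s :: real
    show "ennreal (s powr (g - 1) * (2 / (s * (s\<^sup>2 + 4)))) * indicator {0<..} s
      = (\<integral>\<^sup>+z. ennreal (2 * s powr (g - 2) * exp (- (z * (s\<^sup>2 + 4)))) * indicator {0<..} s * indicator {0<..} z \<partial>lborel)"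
    proof (cases "s > 0")
      case True
      have s4: "s\<^sup>2 + 4 > 0" by (simp add: add_nonneg_pos)
      \<comment> \<open>The factor \<open>z powr (1 - 1)\<close> is 1 on the half line; it gives the
        exponential the shape of a Gamma integral with \<open>p = 1\<close>.\<close>
      have "(\<integral>\<^sup>+z. ennreal (2 * s powr (g - 2) * exp (- (z * (s\<^sup>2 + 4)))) * indicator {0<..} s * indicator {0<..} z \<partial>lborel)
        = (\<integral>\<^sup>+z. ennreal (2 * s powr (g - 2)) * (ennreal (z powr (1 - 1) * exp (- ((s\<^sup>2 + 4) * z))) * indicator {0<..} z) \<partial>lborel)"
        using True by (intro nn_integral_cong) (auto simp: indicator_def mult.commute simp flip: ennreal_mult')
      also have "\<dots> = ennreal (2 * s powr (g - 2)) * ennreal (Gamma 1 * (s\<^sup>2 + 4) powr - 1)"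
        using nn_integral_Gamma_scaled[OF zero_less_one s4] by (simp add: nn_integral_cmult)
      also have "\<dots> = ennreal (2 * s powr (g - 2) / (s\<^sup>2 + 4))"
        using s4 by (simp add: powr_minus field_simps flip: ennreal_mult')
      also have "2 * s powr (g - 2) / (s\<^sup>2 + 4) = s powr (g - 1) * (2 / (s * (s\<^sup>2 + 4)))"
        using True by (simp add: powr_diff power2_eq_square field_simps)
      finally show ?thesis using True by simp
    qed simp
  qed
  also have "\<dots> = (\<integral>\<^sup>+z. (\<integral>\<^sup>+s. ennreal (2 * s powr (g - 2) * exp (- (z * (s\<^sup>2 + 4)))) * indicator {0<..} s * indicator {0<..} z \<partial>lborel) \<partial>lborel)"
    by (rule lborel_pair.Fubini') measurable
  also have "\<dots> = (\<integral>\<^sup>+z. ennreal (Gamma a) * (ennreal (z powr ((1 - a) - 1) * exp (- (4 * z))) * indicator {0<..} z) \<partial>lborel)"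
  proof (intro nn_integral_cong)
    fix z :: real
    show "(\<integral>\<^sup>+s. ennreal (2 * s powr (g - 2) * exp (- (z * (s\<^sup>2 + 4)))) * indicator {0<..} s * indicator {0<..} z \<partial>lborel)
      = ennreal (Gamma a) * (ennreal (z powr ((1 - a) - 1) * exp (- (4 * z))) * indicator {0<..} z)"
      by (cases "z > 0") (simp_all add: inner nn_integral_multc)
  qed
  also have "\<dots> = ennreal (Gamma a) * ennreal (Gamma (1 - a) * 4 powr - (1 - a))"
    using nn_integral_Gamma_scaled[of "1 - a" 4] a by (simp add: nn_integral_cmult)
  also have "\<dots> = ennreal (Gamma a * Gamma (1 - a) * 4 powr - (1 - a))"
    using a by (simp add: mult_ac flip: ennreal_mult')
  also have "Gamma a * Gamma (1 - a) * 4 powr - (1 - a) = 2 powr (g - 3) * pi / sin (pi * ((g - 1) / 2))"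
  proof -
    have "2 * - (1 - a) = g - 3" by (simp add: a_def field_simps)
    moreover have "(4::real) powr - (1 - a) = (2 powr 2) powr - (1 - a)" by simp
    ultimately have "(4::real) powr - (1 - a) = 2 powr (g - 3)" by (simp only: powr_powr)
    then show ?thesis unfolding Gamma_reflection_real[OF a] by (simp add: a_def)
  qed
  finally show ?thesis .
qed

lemma nn_integral_sin_squared_powr:
  assumes g: "1 < g" "g \<le> (2::real)"
  shows "(\<integral>\<^sup>+y\<in>{0<..}. ennreal ((sin y)\<^sup>2 * y powr - g) \<partial>lborel)
    = ennreal (2 powr (g - 3) * pi / (sin (pi * ((g - 1) / 2)) * Gamma g))"
proof -
  have G: "Gamma g > 0" using g by (intro Gamma_real_pos) simp
  \<comment> \<open>\<open>Gamma g\<close> is carried along and divided out at the end, because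
    \<open>Gamma g * y powr - g\<close> is exactly a Gamma integral. What remains in
    \<open>y\<close> after the exchange is the Laplace transform of
    \<open>(sin y)\<^sup>2\<close>.\<close>
  have "ennreal (Gamma g) * (\<integral>\<^sup>+y\<in>{0<..}. ennreal ((sin y)\<^sup>2 * y powr - g) \<partial>lborel)
      = (\<integral>\<^sup>+y\<in>{0<..}. ennreal ((sin y)\<^sup>2) * ennreal (Gamma g * y powr - g) \<partial>lborel)"
    using G by (subst nn_integral_cmult[symmetric])
      (auto intro!: nn_integral_cong simp: mult_ac indicator_def simp flip: ennreal_mult')
  also have "\<dots> = (\<integral>\<^sup>+y. (\<integral>\<^sup>+s. ennreal ((sin y)\<^sup>2 * (s powr (g - 1) * exp (- (y * s)))) * indicator {0<..} s * indicator {0<..} y \<partial>lborel) \<partial>lborel)"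
  proof (intro nn_integral_cong)
    fix y :: real
    show "ennreal ((sin y)\<^sup>2) * ennreal (Gamma g * y powr - g) * indicator {0<..} y
      = (\<integral>\<^sup>+s. ennreal ((sin y)\<^sup>2 * (s powr (g - 1) * exp (- (y * s)))) * indicator {0<..} s * indicator {0<..} y \<partial>lborel)"
      by (cases "y > 0") (use g in \<open>simp_all add: nn_integral_cmult mult.assoc ennreal_mult'[of "(sin y)\<^sup>2"] flip: nn_integral_Gamma_scaled\<close>)
  qed
  also have "\<dots> = (\<integral>\<^sup>+s. (\<integral>\<^sup>+y. ennreal ((sin y)\<^sup>2 * (s powr (g - 1) * exp (- (y * s)))) * indicator {0<..} s * indicator {0<..} y \<partial>lborel) \<partial>lborel)"
    by (rule lborel_pair.Fubini') measurable
  also have "\<dots> = (\<integral>\<^sup>+s\<in>{0<..}. ennreal (s powr (g - 1) * (2 / (s * (s\<^sup>2 + 4)))) \<partial>lborel)"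
  proof (intro nn_integral_cong)
    fix s :: real
    show "(\<integral>\<^sup>+y. ennreal ((sin y)\<^sup>2 * (s powr (g - 1) * exp (- (y * s)))) * indicator {0<..} s * indicator {0<..} y \<partial>lborel)
      = ennreal (s powr (g - 1) * (2 / (s * (s\<^sup>2 + 4)))) * indicator {0<..} s"
    proof (cases "s > 0")
      case True
      have "(\<integral>\<^sup>+y. ennreal ((sin y)\<^sup>2 * (s powr (g - 1) * exp (- (y * s)))) * indicator {0<..} s * indicator {0<..} y \<partial>lborel)
        = (\<integral>\<^sup>+y. ennreal (s powr (g - 1)) * (ennreal ((sin y)\<^sup>2 * exp (- (y * s))) * indicator {0<..} y) \<partial>lborel)"
        using True by (intro nn_integral_cong) (auto simp: indicator_def mult_ac simp flip: ennreal_mult')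
      also have "\<dots> = ennreal (s powr (g - 1)) * ennreal (2 / (s * (s\<^sup>2 + 4)))"
        by (subst nn_integral_cmult) (auto simp: nn_integral_exp_sin_squared[OF True])
      also have "\<dots> = ennreal (s powr (g - 1) * (2 / (s * (s\<^sup>2 + 4))))"
        by (rule ennreal_mult'[symmetric]) simp
      finally show ?thesis using True by simp
    qed simp
  qed
  also have "\<dots> = ennreal (2 powr (g - 3) * pi / sin (pi * ((g - 1) / 2)))"
    by (rule nn_integral_powr_div_quadratic[OF g])
  finally have "ennreal (1 / Gamma g) * (ennreal (Gamma g) * (\<integral>\<^sup>+y\<in>{0<..}. ennreal ((sin y)\<^sup>2 * y powr - g) \<partial>lborel))
    = ennreal (1 / Gamma g) * ennreal (2 powr (g - 3) * pi / sin (pi * ((g - 1) / 2)))" by simp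
  then show ?thesis using G by (simp add: mult.commute flip: mult.assoc ennreal_mult')
qed

section \<open>Folding onto the half line\<close>

lemma nn_integral_eq_half_line:
  fixes f :: "real \<Rightarrow> ennreal"
  assumes [measurable]: "f \<in> borel_measurable borel"
  shows "(\<integral>\<^sup>+x. f x \<partial>lborel) = (\<integral>\<^sup>+x\<in>{0<..}. f x + f (- x) \<partial>lborel)"
proof -
  have "(\<integral>\<^sup>+x. f x \<partial>lborel) = (\<integral>\<^sup>+x. f x * indicator {0<..} x + f x * indicator {..<0} x \<partial>lborel)"
    using AE_lborel_singleton[of "0::real"]
    by (intro nn_integral_cong_AE, eventually_elim) (auto simp: indicator_def)
  also have "\<dots> = (\<integral>\<^sup>+x\<in>{0<..}. f x \<partial>lborel) + (\<integral>\<^sup>+x\<in>{..<0}. f x \<partial>lborel)"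
    by (rule nn_integral_add) auto
  also have "(\<integral>\<^sup>+x\<in>{..<0}. f x \<partial>lborel) = (\<integral>\<^sup>+x. f (- x) * indicator {..<0} (- x) \<partial>lborel)"
    using nn_integral_real_affine[of "\<lambda>x. f x * indicator {..<0} x" "-1" 0] by simp
  also have "\<dots> = (\<integral>\<^sup>+x\<in>{0<..}. f (- x) \<partial>lborel)"
    by (intro nn_integral_cong) (auto simp: indicator_def)
  also have "(\<integral>\<^sup>+x\<in>{0<..}. f x \<partial>lborel) + (\<integral>\<^sup>+x\<in>{0<..}. f (- x) \<partial>lborel)
      = (\<integral>\<^sup>+x\<in>{0<..}. f x + f (- x) \<partial>lborel)"
    by (subst nn_integral_add[symmetric]) (auto simp: distrib_right)
  finally show ?thesis .
qed

lemma integral_eq_half_line: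
  fixes f :: "real \<Rightarrow> complex"
  assumes f: "integrable lborel f"
  shows "(\<integral>x. f x \<partial>lborel) = (LINT x:{0<..}|lborel. f x + f (- x))"
proof -
  have f': "integrable lborel (\<lambda>x. f (- x))"
    using lborel_integrable_real_affine[OF f, of "-1" 0] by simp
  have ind: "integrable lborel (\<lambda>x. indicator A x *\<^sub>R h x)"
    if "integrable lborel h" "A \<in> sets borel" for A and h :: "real \<Rightarrow> complex"
    using that by (intro integrable_mult_indicator) auto
  have "(\<integral>x. f x \<partial>lborel) = (\<integral>x. indicator {0<..} x *\<^sub>R f x + indicator {..<0} x *\<^sub>R f x \<partial>lborel)"
  proof (rule integral_cong_AE)
    show "AE x in lborel. f x = indicator {0<..} x *\<^sub>R f x + indicator {..<0} x *\<^sub>R f x"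
      using AE_lborel_singleton[of "0::real"] by eventually_elim (auto simp: indicator_def)
  qed (use borel_measurable_integrable[OF f] in auto)
  also have "\<dots> = (\<integral>x. indicator {0<..} x *\<^sub>R f x \<partial>lborel) + (\<integral>x. indicator {..<0} x *\<^sub>R f x \<partial>lborel)"
    by (intro Bochner_Integration.integral_add ind f) auto
  also have "(\<integral>x. indicator {..<0} x *\<^sub>R f x \<partial>lborel) = (\<integral>x. indicator {..<0} (- x) *\<^sub>R f (- x) \<partial>lborel)"
    by (subst lborel_integral_real_affine[of "-1" _ 0]) auto
  also have "\<dots> = (\<integral>x. indicator {0<..} x *\<^sub>R f (- x) \<partial>lborel)"
    by (intro Bochner_Integration.integral_cong) (auto simp: indicator_def)
  also have "(\<integral>x. indicator {0<..} x *\<^sub>R f x \<partial>lborel) + (\<integral>x. indicator {0<..} x *\<^sub>R f (- x) \<partial>lborel)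
      = (LINT x:{0<..}|lborel. f x + f (- x))"
    unfolding set_lebesgue_integral_def scaleR_add_right
    by (intro Bochner_Integration.integral_add[symmetric] ind f f') auto
  finally show ?thesis .
qed

section \<open>The \<open>L\<^sup>2\<close> Fourier transform\<close>

lemma L2_funD:
  assumes "L2_fun f"
  shows "f \<in> borel_measurable borel" "(\<integral>\<^sup>+x. ennreal ((cmod (f x))\<^sup>2) \<partial>lborel) < \<infinity>"
    "integrable lborel (\<lambda>x. (cmod (f x))\<^sup>2)"
  using assms by (auto simp: L2_fun_def intro!: integrable_cmod_power2I)

text \<open>A set inside a bounded interval has finite measure, so its indicator is
  square-integrable, and a product of two L2 functions is integrable.\<close>

lemma L2_integrable_on_bounded:
  assumes f: "L2_fun f" and A: "A \<in> sets borel" "A \<subseteq> {a..b}"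
  shows "integrable lborel (\<lambda>x. indicator A x *\<^sub>R f x)"
proof -
  have fin: "emeasure lborel A < \<infinity>"
    using emeasure_mono[OF A(2), of lborel] A(1) by (auto simp: order.strict_trans1 emeasure_lborel_Icc_eq split: if_splits)
  have "integrable lborel (\<lambda>x. complex_of_real (indicator A x) * f x)"
  proof (rule integrable_mult_L2)
    have "integrable lborel (indicator A :: real \<Rightarrow> real)"
      using fin A(1) by (intro integrable_real_indicator) auto
    moreover have "(cmod (complex_of_real (indicator A x)))\<^sup>2 = indicator A x" for x
      by (auto simp: indicator_def)
    ultimately show "integrable lborel (\<lambda>x. (cmod (complex_of_real (indicator A x)))\<^sup>2)" by (simp only:)
  qed (use L2_funD[OF f] A in auto)
  then show ?thesis by (simp add: scaleR_conv_of_real)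
qed

text \<open>Domination by \<open>f\<close> itself, along sequences \<open>X\<close> because the real
  parameter is not countable. Exhaustion is asked for where \<open>f\<close> is nonzero, so that the
  sets \<open>S R\<close> may miss a region where \<open>f\<close> vanishes, such as the negative
  half line.\<close>

lemma tendsto_truncation_at_top:
  fixes f :: "real \<Rightarrow> ennreal" and S :: "real \<Rightarrow> real set"
  assumes [measurable]: "f \<in> borel_measurable borel" "\<And>R. S R \<in> sets borel"
    and fin: "(\<integral>\<^sup>+x. f x \<partial>lborel) < \<infinity>"
    and exh: "\<And>x. f x \<noteq> 0 \<Longrightarrow> \<forall>\<^sub>F R in at_top. x \<in> S R"
  shows "((\<lambda>R. \<integral>\<^sup>+x. f x * indicator (S R) x \<partial>lborel) \<longlongrightarrow> (\<integral>\<^sup>+x. f x \<partial>lborel)) at_top"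
proof (rule tendsto_at_topI_sequentially)
  fix X :: "nat \<Rightarrow> real" assume X: "filterlim X at_top sequentially"
  show "(\<lambda>n. \<integral>\<^sup>+x. f x * indicator (S (X n)) x \<partial>lborel) \<longlonglongrightarrow> (\<integral>\<^sup>+x. f x \<partial>lborel)"
  proof (rule nn_integral_dominated_convergence[OF _ _ _ _ fin])
    show "AE x in lborel. (\<lambda>n. f x * indicator (S (X n)) x) \<longlonglongrightarrow> f x"
    proof (rule AE_I2)
      fix x
      show "(\<lambda>n. f x * indicator (S (X n)) x) \<longlonglongrightarrow> f x"
      proof (cases "f x = 0")
        case False
        then have "\<forall>\<^sub>F n in sequentially. x \<in> S (X n)"
          using exh X by (auto simp: filterlim_iff)
        then have "\<forall>\<^sub>F n in sequentially. f x * indicator (S (X n)) x = f x"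
          by eventually_elim simp
        then show ?thesis by (rule tendsto_eventually)
      qed simp
    qed
  qed (auto simp: indicator_def)
qed

lemma truncated_fourier_eq:
  "set_lebesgue_integral lborel {-R..R} (\<lambda>x. cis (- x * t) * f x)
    = fourier (\<lambda>x. indicator {-R..R} x *\<^sub>R f x) t"
  by (simp add: set_lebesgue_integral_def fourier_def)

text \<open>Truncations to \<open>{-R..R}\<close> fall under \<open>plancherel_L1_L2\<close>. As
  \<open>R\<close> grows, the transform side converges by the limit that defines \<open>fh\<close>,
  and the other side by exhaustion.\<close>

lemma L2_fourier_plancherel:
  assumes f: "L2_fun f" and fh: "L2_fourier f fh"
  shows "(\<integral>\<^sup>+t. ennreal ((cmod (fh t))\<^sup>2) \<partial>lborel) = ennreal (2 * pi) * (\<integral>\<^sup>+x. ennreal ((cmod (f x))\<^sup>2) \<partial>lborel)"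
proof (rule L2_limit_norm_eq)
  have [measurable]: "f \<in> borel_measurable borel" using L2_funD[OF f] by simp
  show "((\<lambda>R. \<integral>\<^sup>+t. ennreal ((cmod (fh t - fourier (\<lambda>x. indicator {-R..R} x *\<^sub>R f x) t))\<^sup>2) \<partial>lborel) \<longlongrightarrow> 0) at_top"
    using fh by (simp only: L2_fourier_def truncated_fourier_eq)
  have "(\<integral>\<^sup>+t. ennreal ((cmod (fourier (\<lambda>x. indicator {-R..R} x *\<^sub>R f x) t))\<^sup>2) \<partial>lborel)
    = ennreal (2 * pi) * (\<integral>\<^sup>+x. ennreal ((cmod (f x))\<^sup>2) * indicator {-R..R} x \<partial>lborel)" for R
  proof -
    have sq: "(cmod (indicator {-R..R} x *\<^sub>R f x))\<^sup>2 = indicator {-R..R} x * (cmod (f x))\<^sup>2" for x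
      by (simp add: indicator_def)
    have "integrable lborel (\<lambda>x. (cmod (indicator {-R..R} x *\<^sub>R f x))\<^sup>2)"
      unfolding sq using integrable_mult_indicator[OF _ L2_funD(3)[OF f], of "{-R..R}"] by simp
    moreover have "integrable lborel (\<lambda>x. indicator {-R..R} x *\<^sub>R f x)"
      by (rule L2_integrable_on_bounded[OF f]) auto
    ultimately show ?thesis
      by (subst plancherel_L1_L2) (simp_all only: sq, auto intro!: arg_cong2[of _ _ _ _ "(*)"] nn_integral_cong simp: indicator_def)
  qed
  moreover have "((\<lambda>R. ennreal (2 * pi) * (\<integral>\<^sup>+x. ennreal ((cmod (f x))\<^sup>2) * indicator {-R..R} x \<partial>lborel))
      \<longlongrightarrow> ennreal (2 * pi) * (\<integral>\<^sup>+x. ennreal ((cmod (f x))\<^sup>2) \<partial>lborel)) at_top"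
  proof (intro ennreal_tendsto_cmult tendsto_truncation_at_top L2_funD(2)[OF f])
    fix x :: real
    show "\<forall>\<^sub>F R in at_top. x \<in> {-R..R}"
      using eventually_ge_at_top[of "\<bar>x\<bar>"] by eventually_elim auto
  qed auto
  ultimately show "((\<lambda>R. \<integral>\<^sup>+t. ennreal ((cmod (fourier (\<lambda>x. indicator {-R..R} x *\<^sub>R f x) t))\<^sup>2) \<partial>lborel)
      \<longlongrightarrow> ennreal (2 * pi) * (\<integral>\<^sup>+x. ennreal ((cmod (f x))\<^sup>2) \<partial>lborel)) at_top" by simp
  show "fh \<in> borel_measurable lborel" using fh by (simp add: L2_fourier_def L2_fun_def)
  show "fourier (\<lambda>x. indicator {-R..R} x *\<^sub>R f x) \<in> borel_measurable lborel" for R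
    using borel_measurable_fourier[of "\<lambda>x. indicator {-R..R} x *\<^sub>R f x"] by simp
qed (rule trivial_limit_at_top_linorder)

lemma fourier_odd:
  assumes [measurable]: "g \<in> borel_measurable borel" and odd: "AE x in lborel. g (- x) = - g x"
  shows "fourier g (- t) = - fourier g t"
proof -
  have "fourier g (- t) = (\<integral>x. cis (- x * t) * g (- x) \<partial>lborel)"
    unfolding fourier_def by (subst lborel_integral_real_affine[of "-1" _ 0]) auto
  also have "\<dots> = (\<integral>x. - (cis (- x * t) * g x) \<partial>lborel)"
    using odd by (intro integral_cong_AE) auto
  finally show ?thesis by (simp add: fourier_def)
qed

text \<open>An L2 limit is determined up to a null set, so oddness is inherited a.e. Each truncated
  transform is exactly odd, hence the squared norm of \<open>fh t + fh (- t)\<close> is at most four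
  times the squared approximation error.\<close>

lemma L2_fourier_odd:
  assumes f: "L2_fun f" and fh: "L2_fourier f fh" and odd: "AE x in lborel. f (- x) = - f x"
  shows "AE t in lborel. fh (- t) = - fh t"
proof -
  have [measurable]: "f \<in> borel_measurable borel" "fh \<in> borel_measurable borel"
    using L2_funD[OF f] fh by (auto simp: L2_fourier_def L2_fun_def)
  define F where "F R = fourier (\<lambda>x. indicator {-R..R} x *\<^sub>R f x)" for R
  have [measurable]: "F R \<in> borel_measurable borel" for R unfolding F_def by measurable
  have F_odd: "F R (- t) = - F R t" for R t
    unfolding F_def using odd by (intro fourier_odd) (auto elim!: eventually_mono simp: indicator_def)
  define D where "D R = (\<integral>\<^sup>+t. ennreal ((cmod (fh t - F R t))\<^sup>2) \<partial>lborel)" for R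
  have D: "(D \<longlongrightarrow> 0) at_top"
    using fh unfolding D_def[abs_def] F_def by (simp only: L2_fourier_def truncated_fourier_eq)
  define P where "P = (\<integral>\<^sup>+t. ennreal ((cmod (fh t + fh (- t)))\<^sup>2) \<partial>lborel)"
  have "P \<le> 4 * D R" for R
  proof -
    have "P \<le> ennreal (1 + 1) * D R
        + ennreal (1 + 1/1) * (\<integral>\<^sup>+t. ennreal ((cmod (fh t + fh (- t) - (fh t - F R t)))\<^sup>2) \<partial>lborel)"
      unfolding P_def D_def by (rule nn_integral_cmod_power2_le_weighted) auto
    also have "(\<integral>\<^sup>+t. ennreal ((cmod (fh t + fh (- t) - (fh t - F R t)))\<^sup>2) \<partial>lborel)
        = (\<integral>\<^sup>+t. ennreal ((cmod (fh (- t) - F R (- t)))\<^sup>2) \<partial>lborel)"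
      by (simp add: F_odd)
    also have "\<dots> = D R"
      unfolding D_def using nn_integral_real_affine[of "\<lambda>t. ennreal ((cmod (fh t - F R t))\<^sup>2)" "-1" 0] by simp
    also have "ennreal (1 + 1) * D R + ennreal (1 + 1/1) * D R = 4 * D R"
      by (simp flip: distrib_right)
    finally show ?thesis .
  qed
  moreover have "((\<lambda>R. 4 * D R) \<longlongrightarrow> 4 * 0) at_top"
    by (intro ennreal_tendsto_cmult D) auto
  ultimately have "P \<le> 4 * 0"
    by (intro tendsto_lowerbound[of "\<lambda>R. 4 * D R" _ at_top]) auto
  then have "(\<integral>\<^sup>+t. ennreal ((cmod (fh t + fh (- t)))\<^sup>2) \<partial>lborel) = 0" by (simp add: P_def)
  then have "AE t in lborel. ennreal ((cmod (fh t + fh (- t)))\<^sup>2) = 0"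
    by (subst (asm) nn_integral_0_iff_AE) auto
  then show ?thesis
    by eventually_elim (simp add: add_eq_0_iff)
qed

section \<open>The time norm of the solution\<close>

text \<open>This bound keeps the time norm finite at a fixed \<open>x\<close>. For
  \<open>s \<ge> 1\<close> the power is at most 1; for \<open>s < 1\<close> it may blow up, and
  \<open>\<bar>sin (x * s)\<bar> \<le> \<bar>x * s\<bar>\<close> compensates, leaving
  \<open>x\<^sup>2 * s powr (3 - g)\<close>.\<close>

lemma powr_mult_sin_squared_le:
  assumes g: "1 < g" "g \<le> (2::real)" and s: "s > 0"
  shows "s powr (1 - g) * (sin (x * s))\<^sup>2 \<le> 1 + x\<^sup>2"
proof (cases "s \<ge> 1")
  case True
  have "s powr (1 - g) \<le> s powr 0" using True g by (intro powr_mono) auto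
  then have "s powr (1 - g) * (sin (x * s))\<^sup>2 \<le> 1 * 1"
    using s by (intro mult_mono) (auto simp: power_le_one_iff abs_square_le_1)
  then show ?thesis by (simp add: add_increasing2)
next
  case False
  have "(sin (x * s))\<^sup>2 \<le> (x * s)\<^sup>2"
    using abs_sin_x_le_abs_x[of "x * s"] by (simp add: abs_le_square_iff)
  then have "s powr (1 - g) * (sin (x * s))\<^sup>2 \<le> s powr (1 - g) * (x * s)\<^sup>2"
    by (intro mult_left_mono) auto
  also have "\<dots> = x\<^sup>2 * (s powr (1 - g) * s powr 2)"
    using s by (simp add: power_mult_distrib mult_ac)
  also have "\<dots> = x\<^sup>2 * s powr (3 - g)" by (simp flip: powr_add)
  also have "\<dots> \<le> x\<^sup>2 * 1 powr (3 - g)" using False s g by (intro mult_left_mono powr_mono2) auto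
  finally show ?thesis by simp
qed

text \<open>The exponent may have either sign, so the maximum sits at one end of the interval or the
  other; the sum of the two endpoint values covers both cases.\<close>

lemma powr_bounded_between:
  fixes y R a :: real
  assumes "R > 0" "1 / R \<le> y" "y \<le> R"
  shows "y powr a \<le> R powr a + (1 / R) powr a"
proof (cases "a \<ge> 0")
  case True
  have "0 < y" using assms by (meson divide_pos_pos less_le_trans zero_less_one)
  then have "y powr a \<le> R powr a" using assms True by (intro powr_mono2) auto
  then show ?thesis by (simp add: add_increasing2)
next
  case False
  then have "y powr a \<le> (1 / R) powr a" using assms by (intro powr_mono2') auto
  then show ?thesis by (simp add: add_increasing)
qed

section \<open>Plancherel in time at a fixed position, for odd data\<close>

context
  fixes \<alpha> \<beta> :: real and ph :: "real \<Rightarrow> complex"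
  assumes \<beta>: "0 < \<beta>" and \<gamma>: "1 < \<beta> - 2 * \<alpha>" "\<beta> - 2 * \<alpha> \<le> 2"
    and ph: "L2_fun ph" and odd: "AE s in lborel. ph (- s) = - ph s"
begin

lemma measurable_ph [measurable]: "ph \<in> borel_measurable borel"
  using L2_funD[OF ph] by simp

lemma borel_measurable_trunc_sol [measurable]: "trunc_sol \<alpha> \<beta> ph R x \<in> borel_measurable borel"
  unfolding trunc_sol_def set_lebesgue_integral_def by measurable

text \<open>Oddness folds the frequency integral onto the half line, and \<open>w = s powr \<beta>\<close> turns the
  time dependence into a Fourier transform in \<open>w\<close>.\<close>
lemma trunc_sol_eq_fourier:
  assumes R: "R > 0"
  defines "k \<equiv> \<lambda>x s. indicator {1/R..R} s *\<^sub>R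
    (complex_of_real (s powr (\<alpha> + 1 - \<beta>) * sin (x * s) / (pi * \<beta>)) * \<i> * ph s)"
  shows "trunc_sol \<alpha> \<beta> ph R x t = fourier (\<lambda>w. indicator {0<..} w *\<^sub>R k x (w powr (1 / \<beta>))) t"
proof -
  have [measurable]: "k x \<in> borel_measurable borel" unfolding k_def by measurable
  define S where "S = {s. 1 / R \<le> \<bar>s\<bar> \<and> \<bar>s\<bar> \<le> R}"
  define H where "H s = indicator S s *\<^sub>R (complex_of_real (\<bar>s\<bar> powr \<alpha>) * cis (x * s)
    * cis (- (\<bar>s\<bar> powr \<beta>) * t) * ph s)" for s
  have [measurable]: "S \<in> sets borel" unfolding S_def by measurable
  have [measurable]: "H \<in> borel_measurable borel" unfolding H_def by measurable
  have H: "integrable lborel H"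
  proof (rule Bochner_Integration.integrable_bound)
    show "integrable lborel (\<lambda>s. (R powr \<alpha> + (1 / R) powr \<alpha>) *\<^sub>R (indicator S s *\<^sub>R ph s))"
      by (intro integrable_scaleR_right L2_integrable_on_bounded[OF ph, of S "-R" R]) (auto simp: S_def)
    show "AE s in lborel. norm (H s) \<le> norm ((R powr \<alpha> + (1 / R) powr \<alpha>) *\<^sub>R (indicator S s *\<^sub>R ph s))"
      using powr_bounded_between[OF R, of "\<bar>s\<bar>" \<alpha> for s]
      by (intro AE_I2) (auto simp: H_def S_def norm_mult indicator_def intro!: mult_right_mono)
  qed measurable
  have "trunc_sol \<alpha> \<beta> ph R x t = complex_of_real (1 / (2 * pi)) * (\<integral>s. H s \<partial>lborel)"
    by (simp add: trunc_sol_def set_lebesgue_integral_def H_def S_def)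
  also have "\<dots> = (LINT s:{0<..}|lborel. complex_of_real (1 / (2 * pi)) * (H s + H (- s)))"
    by (subst integral_eq_half_line[OF H]) (simp add: set_lebesgue_integral_def)
  \<comment> \<open>The Jacobian \<open>\<beta> * s powr (\<beta> - 1)\<close> is split off so that
    the rest is a function of \<open>s powr \<beta>\<close>; this is the origin of the exponent
    \<open>\<alpha> + 1 - \<beta>\<close> and of the \<open>\<beta>\<close> in the denominator of
    \<open>k\<close>. The folded exponentials give \<open>2 * \<i> * sin (x * s)\<close>, which
    against \<open>1 / (2 * pi)\<close> leaves \<open>\<i> / pi\<close>.\<close>
  also have "\<dots> = (LINT s:{0<..}|lborel. (\<beta> * s powr (\<beta> - 1)) *\<^sub>R (cis (- (s powr \<beta>) * t) * k x ((s powr \<beta>) powr (1 / \<beta>))))"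
    unfolding set_lebesgue_integral_def
  proof (rule integral_cong_AE)
    show "AE s in lborel. indicator {0<..} s *\<^sub>R (complex_of_real (1 / (2 * pi)) * (H s + H (- s)))
      = indicator {0<..} s *\<^sub>R ((\<beta> * s powr (\<beta> - 1)) *\<^sub>R (cis (- (s powr \<beta>) * t) * k x ((s powr \<beta>) powr (1 / \<beta>))))"
      using odd
    proof eventually_elim
      fix s assume o: "ph (- s) = - ph s"
      show "indicator {0<..} s *\<^sub>R (complex_of_real (1 / (2 * pi)) * (H s + H (- s)))
        = indicator {0<..} s *\<^sub>R ((\<beta> * s powr (\<beta> - 1)) *\<^sub>R (cis (- (s powr \<beta>) * t) * k x ((s powr \<beta>) powr (1 / \<beta>))))"
      proof (cases "s > 0 \<and> 1 / R \<le> s \<and> s \<le> R")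
        case True
        then have s: "s > 0" by simp
        have "(s powr \<beta>) powr (1 / \<beta>) = s" using s \<beta> by (simp add: powr_powr)
        moreover have "s powr (\<beta> - 1) * s powr (\<alpha> + 1 - \<beta>) = s powr \<alpha>" by (simp flip: powr_add)
        then have "s powr \<alpha> / pi = \<beta> * s powr (\<beta> - 1) * (s powr (\<alpha> + 1 - \<beta>) / (pi * \<beta>))"
          using \<beta> by (simp add: field_simps)
        then have "complex_of_real (s powr \<alpha> / pi)
          = complex_of_real (\<beta> * s powr (\<beta> - 1)) * complex_of_real (s powr (\<alpha> + 1 - \<beta>) / (pi * \<beta>))"
          by (metis of_real_mult)
        moreover have "cis (x * s) - cis (- (x * s)) = 2 * \<i> * complex_of_real (sin (x * s))"
          by (simp add: complex_eq_iff)
        then have "H s + H (- s) = complex_of_real (s powr \<alpha>) * (2 * \<i> * complex_of_real (sin (x * s)))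
            * cis (- (s powr \<beta>) * t) * ph s"
          using True o by (simp add: H_def S_def algebra_simps flip: distrib_left)
        then have "complex_of_real (1 / (2 * pi)) * (H s + H (- s))
          = complex_of_real (s powr \<alpha> / pi) * (\<i> * complex_of_real (sin (x * s)) * cis (- (s powr \<beta>) * t) * ph s)"
          by simp
        ultimately show ?thesis using True
          by (simp add: k_def scaleR_conv_of_real mult_ac)
      next
        case False
        have "(s powr \<beta>) powr (1 / \<beta>) = s" if "s > 0" using that \<beta> by (simp add: powr_powr)
        with False show ?thesis by (auto simp: H_def S_def k_def indicator_def)
      qed
    qed
  qed auto
  also have "\<dots> = (LINT w:{0<..}|lborel. cis (- w * t) * k x (w powr (1 / \<beta>)))"
    using integral_powr_substitution[OF \<beta>, of "\<lambda>w. cis (- w * t) * k x (w powr (1 / \<beta>))"] by simp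
  also have "\<dots> = fourier (\<lambda>w. indicator {0<..} w *\<^sub>R k x (w powr (1 / \<beta>))) t"
    by (simp add: set_lebesgue_integral_def fourier_def)
  finally show ?thesis .
qed

text \<open>Used twice: it makes the truncated profiles square-integrable, and it is the domination
  hypothesis when the truncation is removed. The bound grows like \<open>1 + x\<^sup>2\<close>, so
  it concerns each \<open>x\<close> separately.\<close>

lemma nn_integral_half_line_finite:
  "(\<integral>\<^sup>+s. ennreal (2 / (pi * \<beta>) * (s powr (1 - (\<beta> - 2 * \<alpha>)) * (sin (x * s))\<^sup>2 * (cmod (ph s))\<^sup>2))
    * indicator {0<..} s \<partial>lborel) < \<infinity>"
proof -
  have "(\<integral>\<^sup>+s. ennreal (2 / (pi * \<beta>) * (s powr (1 - (\<beta> - 2 * \<alpha>)) * (sin (x * s))\<^sup>2 * (cmod (ph s))\<^sup>2))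
      * indicator {0<..} s \<partial>lborel)
    \<le> (\<integral>\<^sup>+s. ennreal (2 / (pi * \<beta>) * (1 + x\<^sup>2)) * ennreal ((cmod (ph s))\<^sup>2) \<partial>lborel)"
  proof (intro nn_integral_mono)
    fix s :: real
    show "ennreal (2 / (pi * \<beta>) * (s powr (1 - (\<beta> - 2 * \<alpha>)) * (sin (x * s))\<^sup>2 * (cmod (ph s))\<^sup>2)) * indicator {0<..} s
      \<le> ennreal (2 / (pi * \<beta>) * (1 + x\<^sup>2)) * ennreal ((cmod (ph s))\<^sup>2)"
    proof (cases "s > 0")
      case True
      have "2 / (pi * \<beta>) * (s powr (1 - (\<beta> - 2 * \<alpha>)) * (sin (x * s))\<^sup>2 * (cmod (ph s))\<^sup>2)
          \<le> 2 / (pi * \<beta>) * ((1 + x\<^sup>2) * (cmod (ph s))\<^sup>2)"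
        using powr_mult_sin_squared_le[OF \<gamma> True] \<beta> by (intro mult_left_mono mult_right_mono) auto
      then have "ennreal (2 / (pi * \<beta>) * (s powr (1 - (\<beta> - 2 * \<alpha>)) * (sin (x * s))\<^sup>2 * (cmod (ph s))\<^sup>2))
          \<le> ennreal (2 / (pi * \<beta>) * (1 + x\<^sup>2) * (cmod (ph s))\<^sup>2)"
        by (intro ennreal_leI) (simp only: mult.assoc)
      also have "\<dots> = ennreal (2 / (pi * \<beta>) * (1 + x\<^sup>2)) * ennreal ((cmod (ph s))\<^sup>2)"
        using \<beta> by (intro ennreal_mult') auto
      finally show ?thesis using True by simp
    qed simp
  qed
  also have "\<dots> < \<infinity>"
    using L2_funD(2)[OF ph] by (simp add: nn_integral_cmult ennreal_mult_less_top)
  finally show ?thesis .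
qed

text \<open>The squared profile and the Jacobian contribute
  \<open>\<beta> / (pi * \<beta>)\<^sup>2\<close>, which the 2\<pi> of Plancherel turns into
  \<open>2 / (pi * \<beta>)\<close>. The exponents add up as \<open>(\<beta> - 1) + 2 * (\<alpha> +
  1 - \<beta>) = 1 - (\<beta> - 2 * \<alpha>)\<close>.\<close>

lemma nn_integral_trunc_sol:
  assumes R: "R > 0"
  shows "(\<integral>\<^sup>+t. ennreal ((cmod (trunc_sol \<alpha> \<beta> ph R x t))\<^sup>2) \<partial>lborel)
    = (\<integral>\<^sup>+s. (ennreal (2 / (pi * \<beta>) * (s powr (1 - (\<beta> - 2 * \<alpha>)) * (sin (x * s))\<^sup>2 * (cmod (ph s))\<^sup>2))
      * indicator {0<..} s) * indicator {1/R..R} s \<partial>lborel)"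
proof -
  define k where "k s = indicator {1/R..R} s *\<^sub>R
    (complex_of_real (s powr (\<alpha> + 1 - \<beta>) * sin (x * s) / (pi * \<beta>)) * \<i> * ph s)" for s
  define G where "G w = indicator {0<..} w *\<^sub>R k (w powr (1 / \<beta>))" for w
  have [measurable]: "k \<in> borel_measurable borel" unfolding k_def by measurable
  have [measurable]: "G \<in> borel_measurable borel" unfolding G_def by measurable
  have "(\<integral>\<^sup>+w. ennreal ((cmod (G w))\<^sup>2) \<partial>lborel) = (\<integral>\<^sup>+w\<in>{0<..}. ennreal ((cmod (k (w powr (1 / \<beta>))))\<^sup>2) \<partial>lborel)"
    by (intro nn_integral_cong) (auto simp: G_def indicator_def)
  also have "\<dots> = (\<integral>\<^sup>+s\<in>{0<..}. ennreal (\<beta> * s powr (\<beta> - 1)) * ennreal ((cmod (k ((s powr \<beta>) powr (1 / \<beta>))))\<^sup>2) \<partial>lborel)"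
    using nn_integral_powr_substitution[OF \<beta>, of "\<lambda>w. ennreal ((cmod (k (w powr (1 / \<beta>))))\<^sup>2)"] by simp
  also have "\<dots> = (\<integral>\<^sup>+s. ennreal (1 / (2 * pi)) * ((ennreal (2 / (pi * \<beta>) * (s powr (1 - (\<beta> - 2 * \<alpha>)) * (sin (x * s))\<^sup>2 * (cmod (ph s))\<^sup>2))
      * indicator {0<..} s) * indicator {1/R..R} s) \<partial>lborel)"
  proof (intro nn_integral_cong)
    fix s :: real
    show "ennreal (\<beta> * s powr (\<beta> - 1)) * ennreal ((cmod (k ((s powr \<beta>) powr (1 / \<beta>))))\<^sup>2) * indicator {0<..} s
      = ennreal (1 / (2 * pi)) * ((ennreal (2 / (pi * \<beta>) * (s powr (1 - (\<beta> - 2 * \<alpha>)) * (sin (x * s))\<^sup>2 * (cmod (ph s))\<^sup>2))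
      * indicator {0<..} s) * indicator {1/R..R} s)"
    proof (cases "s > 0 \<and> s \<in> {1/R..R}")
      case True
      then have s: "(s powr \<beta>) powr (1 / \<beta>) = s" using \<beta> by (simp add: powr_powr)
      have p: "s powr (\<beta> - 1) * (s powr (\<alpha> + 1 - \<beta>))\<^sup>2 = s powr (1 - (\<beta> - 2 * \<alpha>))"
        by (simp add: power2_eq_square flip: powr_add) (simp add: algebra_simps)
      have "(cmod (k s))\<^sup>2 = (s powr (\<alpha> + 1 - \<beta>))\<^sup>2 * (sin (x * s))\<^sup>2 * (cmod (ph s))\<^sup>2 / (pi * \<beta>)\<^sup>2"
        using True by (simp add: k_def norm_mult norm_divide power_mult_distrib power_divide)
      then have "\<beta> * s powr (\<beta> - 1) * (cmod (k s))\<^sup>2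
          = \<beta> / (pi * \<beta>)\<^sup>2 * (s powr (\<beta> - 1) * (s powr (\<alpha> + 1 - \<beta>))\<^sup>2 * (sin (x * s))\<^sup>2 * (cmod (ph s))\<^sup>2)"
        by simp
      also have "\<dots> = 1 / (2 * pi) * (2 / (pi * \<beta>) * (s powr (1 - (\<beta> - 2 * \<alpha>)) * (sin (x * s))\<^sup>2 * (cmod (ph s))\<^sup>2))"
        unfolding p using \<beta> by (simp add: power2_eq_square)
      finally show ?thesis using True s \<beta> by (simp flip: ennreal_mult')
    next
      case False
      have "(s powr \<beta>) powr (1 / \<beta>) = s" if "s > 0" using that \<beta> by (simp add: powr_powr)
      with False show ?thesis by (cases "s > 0") (auto simp: k_def)
    qed
  qed
  also have "\<dots> = ennreal (1 / (2 * pi)) * (\<integral>\<^sup>+s. (ennreal (2 / (pi * \<beta>) * (s powr (1 - (\<beta> - 2 * \<alpha>)) * (sin (x * s))\<^sup>2 * (cmod (ph s))\<^sup>2))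
      * indicator {0<..} s) * indicator {1/R..R} s \<partial>lborel)"
    (is "_ = _ * ?N") by (rule nn_integral_cmult) measurable
  finally have norm: "(\<integral>\<^sup>+w. ennreal ((cmod (G w))\<^sup>2) \<partial>lborel) = ennreal (1 / (2 * pi)) * ?N" .
  have "?N \<le> (\<integral>\<^sup>+s. ennreal (2 / (pi * \<beta>) * (s powr (1 - (\<beta> - 2 * \<alpha>)) * (sin (x * s))\<^sup>2 * (cmod (ph s))\<^sup>2))
    * indicator {0<..} s \<partial>lborel)"
    by (intro nn_integral_mono) (auto simp: indicator_def)
  then have "?N < \<infinity>" using nn_integral_half_line_finite by (rule order.strict_trans1)
  then have G_L2: "L2_fun G" using norm by (simp add: L2_fun_def ennreal_mult_less_top)
  \<comment> \<open>Frequencies at most \<open>R\<close> confine \<open>G\<close> to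
    \<open>{0..R powr \<beta>}\<close>, and on a bounded interval square-integrability yields the
    integrability that Plancherel asks for.\<close>
  have "integrable lborel (\<lambda>w. indicator {0..R powr \<beta>} w *\<^sub>R G w)"
    by (rule L2_integrable_on_bounded[OF G_L2]) auto
  moreover have "indicator {0..R powr \<beta>} w *\<^sub>R G w = G w" for w
  proof (cases "w > 0 \<and> w powr (1 / \<beta>) \<le> R")
    case True
    then have "(w powr (1 / \<beta>)) powr \<beta> \<le> R powr \<beta>" using \<beta> by (intro powr_mono2) auto
    then show ?thesis using True \<beta> by (simp add: powr_powr)
  qed (auto simp: G_def k_def)
  ultimately have G_int: "integrable lborel G" by simp
  have "(\<integral>\<^sup>+t. ennreal ((cmod (trunc_sol \<alpha> \<beta> ph R x t))\<^sup>2) \<partial>lborel) = (\<integral>\<^sup>+t. ennreal ((cmod (fourier G t))\<^sup>2) \<partial>lborel)"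
    unfolding trunc_sol_eq_fourier[OF R] G_def k_def ..
  also have "\<dots> = ennreal (2 * pi) * (ennreal (1 / (2 * pi)) * ?N)"
    unfolding norm[symmetric] by (rule plancherel_L1_L2[OF G_int L2_funD(3)[OF G_L2]])
  also have "\<dots> = ?N" by (simp flip: mult.assoc ennreal_mult')
  finally show ?thesis .
qed

text \<open>For each single \<open>x\<close> the truncated solutions converge to \<open>u x\<close>
  in L2 of time, so their norms converge; on the frequency side the intervals
  \<open>{1/R..R}\<close> exhaust the positive half line.\<close>

lemma nn_integral_frac_grad_sol:
  assumes u: "frac_grad_sol \<alpha> \<beta> ph u"
  shows "(\<integral>\<^sup>+t. ennreal ((cmod (u x t))\<^sup>2) \<partial>lborel)
    = (\<integral>\<^sup>+s. ennreal (2 / (pi * \<beta>) * (s powr (1 - (\<beta> - 2 * \<alpha>)) * (sin (x * s))\<^sup>2 * (cmod (ph s))\<^sup>2))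
      * indicator {0<..} s \<partial>lborel)" (is "_ = ?L")
proof (rule L2_limit_norm_eq)
  have [measurable]: "(\<lambda>(x, t). u x t) \<in> borel_measurable (borel \<Otimes>\<^sub>M borel)"
    using u by (simp add: frac_grad_sol_def cong: measurable_cong_sets)
  show "u x \<in> borel_measurable lborel" by measurable
  show "((\<lambda>R. \<integral>\<^sup>+t. ennreal ((cmod (u x t - trunc_sol \<alpha> \<beta> ph R x t))\<^sup>2) \<partial>lborel) \<longlongrightarrow> 0) at_top"
    using u by (simp add: frac_grad_sol_def)
  have "((\<lambda>R. \<integral>\<^sup>+s. (ennreal (2 / (pi * \<beta>) * (s powr (1 - (\<beta> - 2 * \<alpha>)) * (sin (x * s))\<^sup>2 * (cmod (ph s))\<^sup>2))
      * indicator {0<..} s) * indicator {1/R..R} s \<partial>lborel) \<longlongrightarrow> ?L) at_top"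
  proof (rule tendsto_truncation_at_top[OF _ _ nn_integral_half_line_finite])
    fix s :: real
    assume "ennreal (2 / (pi * \<beta>) * (s powr (1 - (\<beta> - 2 * \<alpha>)) * (sin (x * s))\<^sup>2 * (cmod (ph s))\<^sup>2)) * indicator {0<..} s \<noteq> 0"
    then have s: "s > 0" by (auto simp: indicator_def split: if_splits)
    show "\<forall>\<^sub>F R in at_top. s \<in> {1/R..R}"
      using eventually_ge_at_top[of s] eventually_ge_at_top[of "1/s"] eventually_gt_at_top[of 0]
      by eventually_elim (use s in \<open>auto simp: field_simps\<close>)
  qed measurable
  moreover have "\<forall>\<^sub>F R in at_top. (\<integral>\<^sup>+s. (ennreal (2 / (pi * \<beta>) * (s powr (1 - (\<beta> - 2 * \<alpha>)) * (sin (x * s))\<^sup>2 * (cmod (ph s))\<^sup>2))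
      * indicator {0<..} s) * indicator {1/R..R} s \<partial>lborel) = (\<integral>\<^sup>+t. ennreal ((cmod (trunc_sol \<alpha> \<beta> ph R x t))\<^sup>2) \<partial>lborel)"
    using eventually_gt_at_top[of 0] by eventually_elim (simp only: nn_integral_trunc_sol)
  ultimately show "((\<lambda>R. \<integral>\<^sup>+t. ennreal ((cmod (trunc_sol \<alpha> \<beta> ph R x t))\<^sup>2) \<partial>lborel) \<longlongrightarrow> ?L) at_top"
    by (rule Lim_transform_eventually)
qed (auto simp: trivial_limit_at_top_linorder)

end

section \<open>The Kato constant\<close>

text \<open>Evenness in \<open>x\<close> gives the factor 2, and the scaling
  \<open>y = s * x\<close> gives \<open>s powr (g - 1)\<close>, the exact inverse of the weight
  \<open>s powr (1 - g)\<close> in the time norm.\<close>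

lemma nn_integral_sin_squared_powr_scaled:
  assumes g: "1 < g" "g \<le> (2::real)" and s: "s > 0"
  shows "(\<integral>\<^sup>+x. ennreal ((sin (x * s))\<^sup>2 * \<bar>x\<bar> powr - g) \<partial>lborel)
    = ennreal (2 * (2 powr (g - 3) * pi / (sin (pi * ((g - 1) / 2)) * Gamma g)) * s powr (g - 1))"
proof -
  define I where "I = 2 powr (g - 3) * pi / (sin (pi * ((g - 1) / 2)) * Gamma g)"
  define X where "X = (\<integral>\<^sup>+x\<in>{0<..}. ennreal ((sin (x * s))\<^sup>2 * x powr - g) \<partial>lborel)"
  have "ennreal I = (\<integral>\<^sup>+y\<in>{0<..}. ennreal ((sin y)\<^sup>2 * y powr - g) \<partial>lborel)"
    unfolding I_def by (rule nn_integral_sin_squared_powr[OF g, symmetric])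
  also have "\<dots> = ennreal s * (\<integral>\<^sup>+x. ennreal ((sin (s * x))\<^sup>2 * (s * x) powr - g) * indicator {0<..} (s * x) \<partial>lborel)"
    using s by (subst nn_integral_real_affine[where c=s and t=0]) auto
  also have "(\<integral>\<^sup>+x. ennreal ((sin (s * x))\<^sup>2 * (s * x) powr - g) * indicator {0<..} (s * x) \<partial>lborel)
      = (\<integral>\<^sup>+x. ennreal (s powr - g) * (ennreal ((sin (x * s))\<^sup>2 * x powr - g) * indicator {0<..} x) \<partial>lborel)"
    using s by (intro nn_integral_cong)
      (auto simp: indicator_def zero_less_mult_iff powr_mult mult_ac simp flip: ennreal_mult')
  also have "\<dots> = ennreal (s powr - g) * X"
    unfolding X_def by (rule nn_integral_cmult) measurable
  finally have "ennreal (s powr (g - 1)) * ennreal I = ennreal (s powr (g - 1)) * (ennreal s * (ennreal (s powr - g) * X))"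
    by simp
  also have "\<dots> = ennreal (s powr (g - 1) * s * s powr - g) * X"
    using s by (simp add: mult.assoc ennreal_mult')
  also have "s powr (g - 1) * s * s powr - g = 1"
    using s by (simp add: powr_diff powr_minus)
  finally have X: "X = ennreal (s powr (g - 1) * I)" by (simp add: ennreal_mult')
  have "(\<integral>\<^sup>+x. ennreal ((sin (x * s))\<^sup>2 * \<bar>x\<bar> powr - g) \<partial>lborel)
      = (\<integral>\<^sup>+x. 2 * (ennreal ((sin (x * s))\<^sup>2 * x powr - g) * indicator {0<..} x) \<partial>lborel)"
    by (subst nn_integral_eq_half_line) (auto intro!: nn_integral_cong simp: indicator_def mult_2)
  also have "\<dots> = 2 * X" unfolding X_def by (rule nn_integral_cmult) measurable
  also have "\<dots> = ennreal (2 * (s powr (g - 1) * I))" by (simp add: X ennreal_mult'[of 2])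
  finally show ?thesis by (simp add: I_def mult_ac)
qed

text \<open>The reflection formula at \<open>g - 1\<close> trades \<open>Gamma (2 - g)\<close> for
  \<open>Gamma (g - 1)\<close>, the double-angle formula cancels the sine in the numerator, and
  \<open>Gamma g = (g - 1) * Gamma (g - 1)\<close> absorbs the denominator. At \<open>g = 2\<close>
  reflection breaks down, and the limiting value \<open>pi / 2\<close> is compared directly.\<close>

lemma kato_const_eq:
  assumes \<gamma>: "1 < \<beta> - 2 * \<alpha>" "\<beta> - 2 * \<alpha> \<le> 2"
  shows "kato_const \<alpha> \<beta> = 4 / \<beta> * (2 powr (\<beta> - 2 * \<alpha> - 3) * pi
    / (sin (pi * ((\<beta> - 2 * \<alpha> - 1) / 2)) * Gamma (\<beta> - 2 * \<alpha>)))"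
proof -
  define g where "g = \<beta> - 2 * \<alpha>"
  have g: "1 < g" "g \<le> 2" using \<gamma> by (auto simp: g_def)
  have s: "2 - \<beta> + 2 * \<alpha> = 2 - g" "\<beta> - 1 - 2 * \<alpha> = g - 1" by (auto simp: g_def)
  have p: "2 powr (g - 3) = 2 powr g / (8::real)" by (simp add: powr_diff)
  show ?thesis
  proof (cases "g = 2")
    case True
    have "Gamma (2::real) = 1" using Gamma_fact[of 1, where 'a=real] by simp
    then show ?thesis unfolding kato_const_def Let_def s g_def[symmetric] using True by simp
  next
    case False
    \<comment> \<open>With \<open>g = 1 + 2 * a\<close> the sine in the constant is
      \<open>cos (pi * a)\<close> and the sine of the reflection formula is
      \<open>sin (2 * (pi * a))\<close>. Excluding \<open>g = 2\<close> gives
      \<open>a < 1/2\<close>, hence a positive cosine that can be cancelled.\<close>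
    define a where "a = (g - 1) / 2"
    have a: "0 < a" "a < 1 / 2" using g False by (auto simp: a_def)
    have sin: "sin (pi * a) > 0" using a by (intro sin_gt_zero) auto
    have "pi * a < pi * (1 / 2)" "pi * a > 0" using a by (auto intro!: mult_strict_left_mono)
    then have "0 < pi / 2 - pi * a" "pi / 2 - pi * a < pi" using pi_gt_zero by linarith+
    then have cos: "cos (pi * a) > 0" unfolding cos_sin_eq by (intro sin_gt_zero) auto
    have e: "sin ((2 - g) / 2 * pi) = cos (pi * a)"
      unfolding cos_sin_eq by (rule arg_cong[of _ _ sin]) (simp add: a_def field_simps)
    have G1: "Gamma (g - 1) > 0" using g by (intro Gamma_real_pos) simp
    have notin: "g - 1 \<notin> \<int>\<^sub>\<le>\<^sub>0" using nonpos_Ints_nonpos[of "g - 1"] g by force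
    have G: "Gamma g = (g - 1) * Gamma (g - 1)" using Gamma_plus1[of "g - 1"] notin by simp
    have "Gamma (g - 1) * Gamma (2 - g) = pi / sin (2 * (pi * a))"
      using Gamma_reflection_real[of "g - 1"] g False by (simp add: a_def)
    also have "\<dots> = pi / (2 * sin (pi * a) * cos (pi * a))" by (simp only: sin_double)
    finally have "Gamma (2 - g) * cos (pi * a) = pi / (2 * sin (pi * a) * Gamma (g - 1))"
      using sin cos G1 by (simp add: field_simps)
    then have "kato_const \<alpha> \<beta> = 2 powr g * (pi / (2 * sin (pi * a) * Gamma (g - 1))) / (\<beta> * (g - 1))"
      unfolding kato_const_def Let_def s g_def[symmetric] e using False by simp
    also have "\<dots> = 4 / \<beta> * (2 powr (g - 3) * pi / (sin (pi * a) * Gamma g))"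
      unfolding G p by (simp add: mult_ac)
    finally show ?thesis by (simp add: g_def a_def)
  qed
qed

theorem theorem2:
  fixes \<alpha> \<beta> :: real
    and \<phi>0 \<phi>0h :: "real \<Rightarrow> complex"
    and u :: "real \<Rightarrow> real \<Rightarrow> complex"
  assumes "0 < \<beta>"
    and "1 < \<beta> - 2 * \<alpha>" and "\<beta> - 2 * \<alpha> \<le> 2"
    and "L2_fun \<phi>0"
    and "AE x in lborel. \<phi>0 (- x) = - \<phi>0 x"
    and "L2_fourier \<phi>0 \<phi>0h"
    and "frac_grad_sol \<alpha> \<beta> \<phi>0h u"
  shows "(\<integral>\<^sup>+ t. (\<integral>\<^sup>+ x. ennreal ((cmod (u x t))\<^sup>2 / \<bar>x\<bar> powr (\<beta> - 2 * \<alpha>)) \<partial>lborel) \<partial>lborel)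
           = ennreal (kato_const \<alpha> \<beta> * L2_norm_sq \<phi>0)"
proof -
  define g where "g = \<beta> - 2 * \<alpha>"
  have g: "1 < g" "g \<le> 2" using assms by (auto simp: g_def)
  define I where "I = 2 powr (g - 3) * pi / (sin (pi * ((g - 1) / 2)) * Gamma g)"
  have I0: "I \<ge> 0"
  proof -
    have "sin (pi * ((g - 1) / 2)) \<ge> 0" using g by (intro sin_ge_zero) (auto simp: field_simps)
    moreover have "Gamma g > 0" using g by (intro Gamma_real_pos) simp
    ultimately show ?thesis by (simp add: I_def)
  qed
  have ph: "L2_fun \<phi>0h" using assms(6) by (simp add: L2_fourier_def)
  have odd: "AE s in lborel. \<phi>0h (- s) = - \<phi>0h s"
    by (rule L2_fourier_odd[OF assms(4,6,5)])
  have [measurable]: "\<phi>0h \<in> borel_measurable borel" using L2_funD[OF ph] by simp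
  have [measurable]: "(\<lambda>(x, t). u x t) \<in> borel_measurable (borel \<Otimes>\<^sub>M borel)"
    using assms(7) by (simp add: frac_grad_sol_def cong: measurable_cong_sets)
  define X where "X = (\<integral>\<^sup>+s. ennreal ((cmod (\<phi>0h s))\<^sup>2) * indicator {0<..} s \<partial>lborel)"
  \<comment> \<open>Oddness makes the squared modulus of \<open>\<phi>0h\<close> even, so its
    half-line norm is half of the full one. The common factor 2 can be cancelled in
    \<open>ennreal\<close> because it is finite and nonzero.\<close>
  have "2 * X = (\<integral>\<^sup>+s. 2 * (ennreal ((cmod (\<phi>0h s))\<^sup>2) * indicator {0<..} s) \<partial>lborel)"
    unfolding X_def by (rule nn_integral_cmult[symmetric]) measurable
  also have "\<dots> = (\<integral>\<^sup>+s\<in>{0<..}. ennreal ((cmod (\<phi>0h s))\<^sup>2) + ennreal ((cmod (\<phi>0h (- s)))\<^sup>2) \<partial>lborel)"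
    using odd by (intro nn_integral_cong_AE, eventually_elim) (simp add: mult_2 distrib_right)
  also have "\<dots> = (\<integral>\<^sup>+s. ennreal ((cmod (\<phi>0h s))\<^sup>2) \<partial>lborel)"
    by (rule nn_integral_eq_half_line[symmetric]) measurable
  also have "\<dots> = ennreal (2 * pi) * ennreal (L2_norm_sq \<phi>0)"
    using L2_fourier_plancherel[OF assms(4,6)] L2_funD(3)[OF assms(4)]
    by (simp add: nn_integral_eq_integral L2_norm_sq_def)
  also have "\<dots> = 2 * ennreal (pi * L2_norm_sq \<phi>0)" by (simp add: ennreal_mult' mult.assoc)
  finally have X: "X = ennreal (pi * L2_norm_sq \<phi>0)" by (simp add: ennreal_mult_cancel_left)
  \<comment> \<open>The time norm is known at fixed \<open>x\<close>, so the time integral has to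
    become the inner one; joint measurability of \<open>u\<close> justifies the exchange.\<close>
  have "(\<integral>\<^sup>+ t. (\<integral>\<^sup>+ x. ennreal ((cmod (u x t))\<^sup>2 / \<bar>x\<bar> powr g) \<partial>lborel) \<partial>lborel)
      = (\<integral>\<^sup>+ x. (\<integral>\<^sup>+ t. ennreal ((cmod (u x t))\<^sup>2 / \<bar>x\<bar> powr g) \<partial>lborel) \<partial>lborel)"
    by (rule lborel_pair.Fubini') measurable
  also have "\<dots> = (\<integral>\<^sup>+x. (\<integral>\<^sup>+s. ennreal (2 / (pi * \<beta>) * (s powr (1 - g) * (sin (x * s))\<^sup>2 * (cmod (\<phi>0h s))\<^sup>2))
      * indicator {0<..} s * ennreal (\<bar>x\<bar> powr - g) \<partial>lborel) \<partial>lborel)"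
  proof (rule nn_integral_cong)
    fix x :: real
    \<comment> \<open>At \<open>x = 0\<close> both forms of the weight are 0, by the conventions for
      division by 0 and for \<open>0 powr\<close>, so no exceptional point has to be
      removed.\<close>
    have "(\<integral>\<^sup>+ t. ennreal ((cmod (u x t))\<^sup>2 / \<bar>x\<bar> powr g) \<partial>lborel)
        = (\<integral>\<^sup>+ t. ennreal ((cmod (u x t))\<^sup>2) * ennreal (\<bar>x\<bar> powr - g) \<partial>lborel)"
      by (simp add: powr_minus divide_inverse ennreal_mult')
    also have "\<dots> = (\<integral>\<^sup>+ t. ennreal ((cmod (u x t))\<^sup>2) \<partial>lborel) * ennreal (\<bar>x\<bar> powr - g)"
      by (rule nn_integral_multc) measurable
    also have "\<dots> = (\<integral>\<^sup>+s. ennreal (2 / (pi * \<beta>) * (s powr (1 - g) * (sin (x * s))\<^sup>2 * (cmod (\<phi>0h s))\<^sup>2))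
        * indicator {0<..} s * ennreal (\<bar>x\<bar> powr - g) \<partial>lborel)"
      unfolding nn_integral_frac_grad_sol[OF assms(1-3) ph odd assms(7)] g_def[symmetric]
      by (rule nn_integral_multc[symmetric]) measurable
    finally show "(\<integral>\<^sup>+ t. ennreal ((cmod (u x t))\<^sup>2 / \<bar>x\<bar> powr g) \<partial>lborel)
        = (\<integral>\<^sup>+s. ennreal (2 / (pi * \<beta>) * (s powr (1 - g) * (sin (x * s))\<^sup>2 * (cmod (\<phi>0h s))\<^sup>2))
          * indicator {0<..} s * ennreal (\<bar>x\<bar> powr - g) \<partial>lborel)" .
  qed
  \<comment> \<open>With \<open>x\<close> innermost at a fixed frequency, the modulus of
    \<open>\<phi>0h s\<close> is a constant factor and the scaled sine integral evaluates the
    rest.\<close>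
  also have "\<dots> = (\<integral>\<^sup>+s. (\<integral>\<^sup>+x. ennreal (2 / (pi * \<beta>) * (s powr (1 - g) * (sin (x * s))\<^sup>2 * (cmod (\<phi>0h s))\<^sup>2))
      * indicator {0<..} s * ennreal (\<bar>x\<bar> powr - g) \<partial>lborel) \<partial>lborel)"
    by (rule lborel_pair.Fubini') measurable
  also have "\<dots> = (\<integral>\<^sup>+s. ennreal (4 * I / (pi * \<beta>)) * (ennreal ((cmod (\<phi>0h s))\<^sup>2) * indicator {0<..} s) \<partial>lborel)"
  proof (intro nn_integral_cong)
    fix s :: real
    show "(\<integral>\<^sup>+x. ennreal (2 / (pi * \<beta>) * (s powr (1 - g) * (sin (x * s))\<^sup>2 * (cmod (\<phi>0h s))\<^sup>2))
        * indicator {0<..} s * ennreal (\<bar>x\<bar> powr - g) \<partial>lborel)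
      = ennreal (4 * I / (pi * \<beta>)) * (ennreal ((cmod (\<phi>0h s))\<^sup>2) * indicator {0<..} s)"
    proof (cases "s > 0")
      case True
      define c where "c = 2 / (pi * \<beta>) * s powr (1 - g) * (cmod (\<phi>0h s))\<^sup>2"
      have c: "c \<ge> 0" using assms(1) by (simp add: c_def)
      have "(\<integral>\<^sup>+x. ennreal (2 / (pi * \<beta>) * (s powr (1 - g) * (sin (x * s))\<^sup>2 * (cmod (\<phi>0h s))\<^sup>2))
          * indicator {0<..} s * ennreal (\<bar>x\<bar> powr - g) \<partial>lborel)
        = (\<integral>\<^sup>+x. ennreal c * ennreal ((sin (x * s))\<^sup>2 * \<bar>x\<bar> powr - g) \<partial>lborel)"
        using True c assms(1)
        by (intro nn_integral_cong) (simp add: c_def mult_ac flip: ennreal_mult'')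
      also have "\<dots> = ennreal c * (\<integral>\<^sup>+x. ennreal ((sin (x * s))\<^sup>2 * \<bar>x\<bar> powr - g) \<partial>lborel)"
        by (rule nn_integral_cmult) measurable
      also have "\<dots> = ennreal c * ennreal (2 * I * s powr (g - 1))"
        unfolding nn_integral_sin_squared_powr_scaled[OF g True] I_def ..
      also have "\<dots> = ennreal (c * (2 * I * s powr (g - 1)))" using c by (simp flip: ennreal_mult')
      also have "c * (2 * I * s powr (g - 1)) = 4 * I / (pi * \<beta>) * (cmod (\<phi>0h s))\<^sup>2 * (s powr (1 - g) * s powr (g - 1))"
        by (simp add: c_def)
      also have "s powr (1 - g) * s powr (g - 1) = 1" using True by (simp flip: powr_add)
      finally show ?thesis using True I0 assms(1) by (simp flip: ennreal_mult')
    qed simp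
  qed
  also have "\<dots> = ennreal (4 * I / (pi * \<beta>)) * X"
    unfolding X_def by (rule nn_integral_cmult) measurable
  also have "\<dots> = ennreal (4 * I / (pi * \<beta>) * (pi * L2_norm_sq \<phi>0))"
    unfolding X using I0 assms(1) by (simp flip: ennreal_mult')
  also have "4 * I / (pi * \<beta>) * (pi * L2_norm_sq \<phi>0) = kato_const \<alpha> \<beta> * L2_norm_sq \<phi>0"
    unfolding kato_const_eq[OF assms(2,3)] I_def g_def by (simp add: mult_ac)
  finally show ?thesis unfolding g_def .
qed

end
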